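(* Let $\mathcal S$ and $\mathcal A$ be finite sets, let $p(s'\mid s,a)$ be the transition probabilities of a Markov decision process with state set $\mathcal S$ and action set $\mathcal A$, and let $\{S_t,A_t,R_{t+1}\}_{t\ge 0}$ be the trajectory of states, actions and real rewards generated by following a behavior policy $\mu$. Assume: 1. the behavior policy $\mu$ has a stationary distribution $d_\mu(s)=\lim_{t\to\infty}\mathbb P\{S_t=s\}$ with $d_\mu(s)>0$ for all $s\in\mathcal S$; 2. $\pi$ is a target policy with coverage: for all $s\in\mathcal S$, $a\in\mathcal A$, if $\pi(a\mid s)>0$ then $\mu(a\mid s)>0$; 3. $\gamma:\mathcal S\to[0,1]$ is a discount function such that $\prod_{k=1}^\infty\gamma(S_{t+k})=0$ with probability one, for all $t>0$; 4. $\lambda:\mathcal S\to[0,1]$ is any bootstrapping function; 5. $i:\mathcal S\to(0,\infty)$ is any (strictly positive) interest function; 6. $\phi:\mathcal S\to\mathbb R^n$ is a feature function such that the matrix $\Phi\in\mathbb R^{|\mathcal S|\times n}$ whose rows are the vectors $\phi(s)^\top$ has linearly independent columns. Let $\rho_t$, $F_t$, $M_t$, $e_t$ be the random sequences of the linear emphatic TD($\lambda$) algorithm (defined in the context), and assume that the limits $\lim_{t\to\infty}\mathbb E_\mu[F_t\mid S_t=s]$ and $\lim_{t\to\infty}\mathbb E_\mu[e_t\mid S_t=s]$ exist (and are finite) for every $s\in\mathcal S$. Then the matrix $$A\doteq\lim_{t\to\infty}\mathbb E_\mu\!\left[e_t\big(\phi(S_t)-\gamma(S_{t+1})\phi(S_{t+1})\big)^\top\right]$$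 satisfies $$A=\Phi^\top \mathbf M\,(I-P_\pi^\lambda)\,\Phi,$$ where $\mathbf M$ and $P_\pi^\lambda$ are the $|\mathcal S|\times|\mathcal S|$ matrices defined in the context, and $A$ is positive definite, i.e. $y^\top A y>0$ for every nonzero $y\in\mathbb R^n$. Consequently linear emphatic TD($\lambda$) is stable (in the sense defined in the context).
   Context: **Policies and expectations.** A policy assigns to each state $s$ a probability distribution $\pi(\cdot\mid s)$ on $\mathcal A$. $\mathbb E_\mu$ denotes expectation when all actions are selected according to $\mu$, i.e. $A_t\sim\mu(\cdot\mid S_t)$ and $S_{t+1}\sim p(\cdot\mid S_t,A_t)$. Rewards have finite mean, and given $(S_t,A_t)$ the pair $(R_{t+1},S_{t+1})$ is independent of the past with a time-independent conditional law. The matrix $P_\pi\in\mathbb R^{|\mathcal S|\times|\mathcal S|}$ is $[P_\pi]_{ss'}=\sum_a\pi(a\mid s)p(s'\mid s,a)$. **Emphatic TD($\lambda$).** The importance sampling ratio is $\rho_t=\pi(A_t\mid S_t)/\mu(A_t\mid S_t)$. Write $\gamma_t=\gamma(S_t)$, $\lambda_t=\lambda(S_t)$, $\phi_t=\phi(S_t)$. Linear emphatic TD($\lambda$) with step size $\alpha>0$ is defined, for $t\ge0$, by - $\theta_{t+1}=\theta_t+\alpha\,(R_{t+1}+\gamma_{t+1}\theta_t^\top\phi_{t+1}-\theta_t^\top\phi_t)\,e_t$, with $\theta_t\in\mathbb R^n$; - $e_t=\rho_t(\gamma_t\lambda_t e_{t-1}+M_t\phi_t)$, with $e_{-1}=0\in\mathbb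 R^n$; - $M_t=\lambda_t\, i(S_t)+(1-\lambda_t)F_t$; - $F_t=\rho_{t-1}\gamma_tF_{t-1}+i(S_t)$ for $t\ge 1$, with $F_0=i(S_0)$. The update can be written $\theta_{t+1}=\theta_t+\alpha(b_t-A_t\theta_t)$ with $b_t=e_tR_{t+1}\in\mathbb R^n$ and $A_t=e_t(\phi_t-\gamma_{t+1}\phi_{t+1})^\top\in\mathbb R^{n\times n}$ (here $A_t$ denotes this matrix, not the action). **Matrices.** $\Gamma$ and $\Lambda$ are the diagonal matrices with diagonal entries $\gamma(s)$ and $\lambda(s)$. $\mathbf M$ is the diagonal matrix with diagonal entries $m(s)=d_\mu(s)\lim_{t\to\infty}\mathbb E_\mu[M_t\mid S_t=s]$. The matrix $P_\pi^\lambda$ is $$P_\pi^\lambda=\sum_{k=0}^\infty(P_\pi\Gamma\Lambda)^kP_\pi\Gamma(I-\Lambda).$$ Its $(i,j)$ entry is the probability that a trajectory started in state $i$ ends in state $j$ with a bootstrapping event, where repeatedly: a transition is made according to $P_\pi$; on arrival in $s$ the trajectory terminates with probability $1-\gamma(s)$; otherwise it ends by bootstrapping with probability $1-\lambda(s)$; otherwise it continues. **Positive definiteness.** A real, not necessarily symmetric, matrix $A$ is positive definite iff $y^\top Ay>0$ for every real vector $y\neq0$. **Stability.** With $A=\lim_t\mathbb E_\mu[A_t]$ and $b=\lim_t\mathbb E_\mu[b_t]$, the stochastic algorithm is called stable iff the deterministic iteration $\bar\theta_{t+1}=\bar\theta_t+\alpha(b-A\bar\theta_t)$ converges, for all sufficiently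 small $\alpha>0$, to a unique fixed point independent of the initial $\bar\theta_0$; equivalently, iff all eigenvalues of $A$ have positive real part. *)

theory Defs
  imports "HOL-Probability.Probability"
begin

text \<open>Events observable before the action at time \<open>t\<close> is drawn, i.e. those determined by
  \<open>S 0, A 0, R 1, S 1, \<dots>, A (t - 1), R t, S t\<close>. The reward \<open>R 0\<close> does not exist in the model;
  the value of \<open>R\<close> at \<open>0\<close> is never used.\<close>

definition history ::
  "'w measure \<Rightarrow> (nat \<Rightarrow> 'w \<Rightarrow> 's) \<Rightarrow> (nat \<Rightarrow> 'w \<Rightarrow> 'a) \<Rightarrow> (nat \<Rightarrow> 'w \<Rightarrow> real) \<Rightarrow> nat \<Rightarrow> 'w set set"
  where
  "history M S A R t = sigma_sets (space M)
     ((\<Union>k\<in>{..t}. {S k -` X \<inter> space M |X. True}) \<union>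
      (\<Union>k\<in>{..<t}. {A k -` X \<inter> space M |X. True}) \<union>
      (\<Union>k\<in>{1..t}. {R k -` B \<inter> space M |B. B \<in> sets borel}))"

text \<open>A trajectory generated by following \<open>\<mu>\<close> from an arbitrary initial distribution. The kernel
  \<open>q s a\<close> is the time-independent conditional law of the pair \<open>(R (t + 1), S (t + 1))\<close> given
  \<open>S t = s\<close>, \<open>A t = a\<close>; its state marginal is \<open>p s a\<close>. Conditional laws are given in product
  form, so nothing is asserted about conditioning on null events.\<close>

locale behavior_trajectory = prob_space M
  for M :: "'w measure"
    and S :: "nat \<Rightarrow> 'w \<Rightarrow> 's::finite"
    and A :: "nat \<Rightarrow> 'w \<Rightarrow> 'a::finite"
    and R :: "nat \<Rightarrow> 'w \<Rightarrow> real"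
    and p :: "'s \<Rightarrow> 'a \<Rightarrow> 's pmf"
    and q :: "'s \<Rightarrow> 'a \<Rightarrow> (real \<times> 's) measure"
    and \<mu> :: "'s \<Rightarrow> 'a pmf" +
  assumes state_measurable: "S t \<in> measurable M (count_space UNIV)"
    and action_measurable: "A t \<in> measurable M (count_space UNIV)"
    and reward_integrable: "integrable M (R (Suc t))"
    and kernel_prob: "prob_space (q s a)"
    and kernel_sets: "sets (q s a) = sets (borel \<Otimes>\<^sub>M count_space UNIV)"
    and kernel_marginal: "measure (q s a) (UNIV \<times> {s'}) = pmf (p s a) s'"
    and action_law:
      "E \<in> history M S A R t \<Longrightarrow>
        measure M {\<omega> \<in> E. S t \<omega> = s \<and> A t \<omega> = a} = measure M {\<omega> \<in> E. S t \<omega> = s} * pmf (\<mu> s) a"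
    and transition_law:
      "E \<in> history M S A R t \<Longrightarrow> B \<in> sets (borel \<Otimes>\<^sub>M count_space UNIV) \<Longrightarrow>
        measure M {\<omega> \<in> E. S t \<omega> = s \<and> A t \<omega> = a \<and> (R (Suc t) \<omega>, S (Suc t) \<omega>) \<in> B}
        = measure M {\<omega> \<in> E. S t \<omega> = s \<and> A t \<omega> = a} * measure (q s a) B"

text \<open>Elementary conditional expectation given an event; it is \<open>0\<close> if the event is null.\<close>

definition expectation_given :: "'w measure \<Rightarrow> ('w \<Rightarrow> 'b) \<Rightarrow> 'w set \<Rightarrow> 'b::euclidean_space" where
  "expectation_given M X E = set_lebesgue_integral M E X /\<^sub>R measure M E"

definition is_ratio ::
  "(nat \<Rightarrow> 'w \<Rightarrow> 's) \<Rightarrow> (nat \<Rightarrow> 'w \<Rightarrow> 'a) \<Rightarrow> ('s \<Rightarrow> 'a pmf) \<Rightarrow> ('s \<Rightarrow> 'a pmf) \<Rightarrow> nat \<Rightarrow> 'w \<Rightarrow> real"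
  where "is_ratio S A \<pi> \<mu> t \<omega> = pmf (\<pi> (S t \<omega>)) (A t \<omega>) / pmf (\<mu> (S t \<omega>)) (A t \<omega>)"

primrec followon ::
  "(nat \<Rightarrow> 'w \<Rightarrow> 's) \<Rightarrow> (nat \<Rightarrow> 'w \<Rightarrow> 'a) \<Rightarrow> ('s \<Rightarrow> 'a pmf) \<Rightarrow> ('s \<Rightarrow> 'a pmf) \<Rightarrow>
   ('s \<Rightarrow> real) \<Rightarrow> ('s \<Rightarrow> real) \<Rightarrow> nat \<Rightarrow> 'w \<Rightarrow> real"
  where
  "followon S A \<pi> \<mu> \<gamma> i 0 = (\<lambda>\<omega>. i (S 0 \<omega>))"
| "followon S A \<pi> \<mu> \<gamma> i (Suc t) =
    (\<lambda>\<omega>. is_ratio S A \<pi> \<mu> t \<omega> * \<gamma> (S (Suc t) \<omega>) * followon S A \<pi> \<mu> \<gamma> i t \<omega> + i (S (Suc t) \<omega>))"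

definition emphasis ::
  "(nat \<Rightarrow> 'w \<Rightarrow> 's) \<Rightarrow> (nat \<Rightarrow> 'w \<Rightarrow> 'a) \<Rightarrow> ('s \<Rightarrow> 'a pmf) \<Rightarrow> ('s \<Rightarrow> 'a pmf) \<Rightarrow>
   ('s \<Rightarrow> real) \<Rightarrow> ('s \<Rightarrow> real) \<Rightarrow> ('s \<Rightarrow> real) \<Rightarrow> nat \<Rightarrow> 'w \<Rightarrow> real"
  where
  "emphasis S A \<pi> \<mu> \<gamma> lam i t \<omega> =
    lam (S t \<omega>) * i (S t \<omega>) + (1 - lam (S t \<omega>)) * followon S A \<pi> \<mu> \<gamma> i t \<omega>"

primrec eligibility ::
  "(nat \<Rightarrow> 'w \<Rightarrow> 's) \<Rightarrow> (nat \<Rightarrow> 'w \<Rightarrow> 'a) \<Rightarrow> ('s \<Rightarrow> 'a pmf) \<Rightarrow> ('s \<Rightarrow> 'a pmf) \<Rightarrow>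
   ('s \<Rightarrow> real) \<Rightarrow> ('s \<Rightarrow> real) \<Rightarrow> ('s \<Rightarrow> real) \<Rightarrow> ('s \<Rightarrow> real^'n) \<Rightarrow> nat \<Rightarrow> 'w \<Rightarrow> real^'n"
  where
  "eligibility S A \<pi> \<mu> \<gamma> lam i \<phi> 0 =
    (\<lambda>\<omega>. is_ratio S A \<pi> \<mu> 0 \<omega> *\<^sub>R (emphasis S A \<pi> \<mu> \<gamma> lam i 0 \<omega> *\<^sub>R \<phi> (S 0 \<omega>)))"
| "eligibility S A \<pi> \<mu> \<gamma> lam i \<phi> (Suc t) =
    (\<lambda>\<omega>. is_ratio S A \<pi> \<mu> (Suc t) \<omega> *\<^sub>R
      ((\<gamma> (S (Suc t) \<omega>) * lam (S (Suc t) \<omega>)) *\<^sub>R eligibility S A \<pi> \<mu> \<gamma> lam i \<phi> t \<omega>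
       + emphasis S A \<pi> \<mu> \<gamma> lam i (Suc t) \<omega> *\<^sub>R \<phi> (S (Suc t) \<omega>)))"

definition outer :: "real^'n \<Rightarrow> real^'m \<Rightarrow> real^'m^'n" where
  "outer u v = (\<chi> j k. u $ j * v $ k)"

definition etd_matrix ::
  "(nat \<Rightarrow> 'w \<Rightarrow> 's) \<Rightarrow> (nat \<Rightarrow> 'w \<Rightarrow> 'a) \<Rightarrow> ('s \<Rightarrow> 'a pmf) \<Rightarrow> ('s \<Rightarrow> 'a pmf) \<Rightarrow>
   ('s \<Rightarrow> real) \<Rightarrow> ('s \<Rightarrow> real) \<Rightarrow> ('s \<Rightarrow> real) \<Rightarrow> ('s \<Rightarrow> real^'n) \<Rightarrow> nat \<Rightarrow> 'w \<Rightarrow> real^'n^'n"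
  where
  "etd_matrix S A \<pi> \<mu> \<gamma> lam i \<phi> t \<omega> =
    outer (eligibility S A \<pi> \<mu> \<gamma> lam i \<phi> t \<omega>)
      (\<phi> (S t \<omega>) - \<gamma> (S (Suc t) \<omega>) *\<^sub>R \<phi> (S (Suc t) \<omega>))"

definition etd_vector ::
  "(nat \<Rightarrow> 'w \<Rightarrow> 's) \<Rightarrow> (nat \<Rightarrow> 'w \<Rightarrow> 'a) \<Rightarrow> (nat \<Rightarrow> 'w \<Rightarrow> real) \<Rightarrow> ('s \<Rightarrow> 'a pmf) \<Rightarrow> ('s \<Rightarrow> 'a pmf) \<Rightarrow>
   ('s \<Rightarrow> real) \<Rightarrow> ('s \<Rightarrow> real) \<Rightarrow> ('s \<Rightarrow> real) \<Rightarrow> ('s \<Rightarrow> real^'n) \<Rightarrow> nat \<Rightarrow> 'w \<Rightarrow> real^'n"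
  where
  "etd_vector S A R \<pi> \<mu> \<gamma> lam i \<phi> t \<omega> = R (Suc t) \<omega> *\<^sub>R eligibility S A \<pi> \<mu> \<gamma> lam i \<phi> t \<omega>"

text \<open>One step of the algorithm has the linear form \<open>\<theta> + \<alpha> (b\<^sub>t - A\<^sub>t \<theta>)\<close>.\<close>

definition etd_update ::
  "(nat \<Rightarrow> 'w \<Rightarrow> 's) \<Rightarrow> (nat \<Rightarrow> 'w \<Rightarrow> 'a) \<Rightarrow> (nat \<Rightarrow> 'w \<Rightarrow> real) \<Rightarrow> ('s \<Rightarrow> 'a pmf) \<Rightarrow> ('s \<Rightarrow> 'a pmf) \<Rightarrow>
   ('s \<Rightarrow> real) \<Rightarrow> ('s \<Rightarrow> real) \<Rightarrow> ('s \<Rightarrow> real) \<Rightarrow> ('s \<Rightarrow> real^'n) \<Rightarrow> real \<Rightarrow> nat \<Rightarrow> 'w \<Rightarrow>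
   real^'n \<Rightarrow> real^'n"
  where
  "etd_update S A R \<pi> \<mu> \<gamma> lam i \<phi> \<alpha> t \<omega> \<theta> = \<theta> +
    (\<alpha> * (R (Suc t) \<omega> + \<gamma> (S (Suc t) \<omega>) * (\<theta> \<bullet> \<phi> (S (Suc t) \<omega>)) - \<theta> \<bullet> \<phi> (S t \<omega>)))
      *\<^sub>R eligibility S A \<pi> \<mu> \<gamma> lam i \<phi> t \<omega>"

lemma outer_mult_vec: "outer u v *v x = (v \<bullet> x) *\<^sub>R u"
  by (simp add: vec_eq_iff outer_def matrix_vector_mult_def inner_vec_def sum_distrib_left
      mult_ac)

lemma etd_update_linear:
  "etd_update S A R \<pi> \<mu> \<gamma> lam i \<phi> \<alpha> t \<omega> \<theta> =
    \<theta> + \<alpha> *\<^sub>R (etd_vector S A R \<pi> \<mu> \<gamma> lam i \<phi> t \<omega> - etd_matrix S A \<pi> \<mu> \<gamma> lam i \<phi> t \<omega> *v \<theta>)"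
  by (simp add: etd_update_def etd_vector_def etd_matrix_def outer_mult_vec inner_commute
      inner_diff_left algebra_simps flip: scaleR_scaleR)

definition diag_matrix :: "('s \<Rightarrow> real) \<Rightarrow> real^'s^'s" where
  "diag_matrix f = (\<chi> s s'. if s = s' then f s else 0)"

text \<open>Powers for \<open>**\<close>; the operator \<open>^\<close> on \<open>real^'s^'s\<close> is the componentwise power.\<close>

primrec matrix_power :: "real^'s^'s \<Rightarrow> nat \<Rightarrow> real^'s^'s" where
  "matrix_power X 0 = mat 1"
| "matrix_power X (Suc k) = X ** matrix_power X k"

definition feature_matrix :: "('s \<Rightarrow> real^'n) \<Rightarrow> real^'n^'s" where
  "feature_matrix \<phi> = (\<chi> s. \<phi> s)"

definition transition_matrix ::
  "('s::finite \<Rightarrow> 'a::finite \<Rightarrow> 's pmf) \<Rightarrow> ('s \<Rightarrow> 'a pmf) \<Rightarrow> real^'s^'s" where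
  "transition_matrix p \<pi> = (\<chi> s s'. \<Sum>a\<in>UNIV. pmf (\<pi> s) a * pmf (p s a) s')"

definition bootstrap_term ::
  "('s::finite \<Rightarrow> 'a::finite \<Rightarrow> 's pmf) \<Rightarrow> ('s \<Rightarrow> 'a pmf) \<Rightarrow> ('s \<Rightarrow> real) \<Rightarrow> ('s \<Rightarrow> real) \<Rightarrow>
   nat \<Rightarrow> real^'s^'s"
  where
  "bootstrap_term p \<pi> \<gamma> lam k =
    matrix_power (transition_matrix p \<pi> ** diag_matrix \<gamma> ** diag_matrix lam) k
      ** transition_matrix p \<pi> ** diag_matrix \<gamma> ** (mat 1 - diag_matrix lam)"

definition bootstrap_matrix ::
  "('s::finite \<Rightarrow> 'a::finite \<Rightarrow> 's pmf) \<Rightarrow> ('s \<Rightarrow> 'a pmf) \<Rightarrow> ('s \<Rightarrow> real) \<Rightarrow> ('s \<Rightarrow> real) \<Rightarrow> real^'s^'s"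
  where "bootstrap_matrix p \<pi> \<gamma> lam = (\<Sum>k. bootstrap_term p \<pi> \<gamma> lam k)"

definition emphasis_matrix ::
  "'w measure \<Rightarrow> (nat \<Rightarrow> 'w \<Rightarrow> 's) \<Rightarrow> (nat \<Rightarrow> 'w \<Rightarrow> 'a) \<Rightarrow> ('s \<Rightarrow> 'a pmf) \<Rightarrow> ('s \<Rightarrow> 'a pmf) \<Rightarrow>
   ('s \<Rightarrow> real) \<Rightarrow> ('s \<Rightarrow> real) \<Rightarrow> ('s \<Rightarrow> real) \<Rightarrow> ('s \<Rightarrow> real) \<Rightarrow> real^'s^'s"
  where
  "emphasis_matrix M S A \<pi> \<mu> \<gamma> lam i d = diag_matrix (\<lambda>s. d s *
    lim (\<lambda>t. expectation_given M (emphasis S A \<pi> \<mu> \<gamma> lam i t) {\<omega> \<in> space M. S t \<omega> = s}))"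

definition positive_definite :: "real^'n^'n \<Rightarrow> bool" where
  "positive_definite X \<longleftrightarrow> (\<forall>y. y \<noteq> 0 \<longrightarrow> y \<bullet> (X *v y) > 0)"

definition stable_iteration :: "real^'n^'n \<Rightarrow> real^'n \<Rightarrow> bool" where
  "stable_iteration X b \<longleftrightarrow>
    (\<forall>\<^sub>F \<alpha> in at_right 0. \<exists>\<theta>'.
      (\<forall>\<theta>. \<theta> + \<alpha> *\<^sub>R (b - X *v \<theta>) = \<theta> \<longleftrightarrow> \<theta> = \<theta>') \<and>
      (\<forall>\<theta>\<^sub>0. (\<lambda>t. ((\<lambda>\<theta>. \<theta> + \<alpha> *\<^sub>R (b - X *v \<theta>)) ^^ t) \<theta>\<^sub>0) \<longlonglongrightarrow> \<theta>'))"

definition etd_stable ::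
  "'w measure \<Rightarrow> (nat \<Rightarrow> 'w \<Rightarrow> 's) \<Rightarrow> (nat \<Rightarrow> 'w \<Rightarrow> 'a) \<Rightarrow> (nat \<Rightarrow> 'w \<Rightarrow> real) \<Rightarrow>
   ('s \<Rightarrow> 'a pmf) \<Rightarrow> ('s \<Rightarrow> 'a pmf) \<Rightarrow>
   ('s \<Rightarrow> real) \<Rightarrow> ('s \<Rightarrow> real) \<Rightarrow> ('s \<Rightarrow> real) \<Rightarrow> ('s \<Rightarrow> real^'n) \<Rightarrow> bool"
  where
  "etd_stable M S A R \<pi> \<mu> \<gamma> lam i \<phi> \<longleftrightarrow>
    (\<exists>X b. (\<lambda>t. \<integral>\<omega>. etd_matrix S A \<pi> \<mu> \<gamma> lam i \<phi> t \<omega> \<partial>M) \<longlonglongrightarrow> X \<and>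
           (\<lambda>t. \<integral>\<omega>. etd_vector S A R \<pi> \<mu> \<gamma> lam i \<phi> t \<omega> \<partial>M) \<longlonglongrightarrow> b \<and>
           stable_iteration X b)"

end

theory Submission
  imports Defs
begin

text \<open>Write \<open>Q = P\<^sub>\<pi> \<Gamma>\<close> and \<open>K = Q \<Lambda>\<close>. Importance sampling turns the recursions for \<open>F\<^sub>t\<close> and
  \<open>e\<^sub>t\<close> into linear recursions for their means on the events \<open>S\<^sub>t = s\<close>, so the limit \<open>f\<close> of the
  former satisfies \<open>f (I - Q) = d\<^sub>\<mu> i\<close>. As \<open>d\<^sub>\<mu> i > 0\<close>, this makes \<open>f\<close> positive and \<open>K\<close> a contraction
  in an \<open>f\<close>-weighted norm, so \<open>N = \<Sum>K\<^sup>k\<close> converges to the inverse of \<open>I - K\<close>. Then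
  \<open>I - P\<^sub>\<pi>\<^sup>\<lambda> = N (I - Q)\<close> and \<open>m = f (I - K)\<close>, hence \<open>m (I - P\<^sub>\<pi>\<^sup>\<lambda>) = f (I - Q) = d\<^sub>\<mu> i\<close>: the matrix
  \<open>\<^bold>M (I - P\<^sub>\<pi>\<^sup>\<lambda>)\<close> has nonpositive off-diagonal entries, nonnegative row sums and positive column
  sums, and is therefore positive definite. Similarly the limit \<open>Z\<close> of the trace means satisfies
  \<open>Z\<^sup>T (I - K) = \<Phi>\<^sup>T \<^bold>M\<close>, so that \<open>A = Z\<^sup>T (I - Q) \<Phi> = \<Phi>\<^sup>T \<^bold>M (I - P\<^sub>\<pi>\<^sup>\<lambda>) \<Phi>\<close>. All variables other than
  the reward are simple functions of the history, which settles every integrability question.\<close>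

section \<open>Positive definite matrices\<close>

text \<open>\<open>columns X\<close> is a set, so a repeated column would be invisible to
  \<open>independent\<close>. Injectivity of the column map restores the count, and the column rank
  is then full.\<close>

lemma inj_matrix_independent_columns:
  fixes X :: "real^'n^'m"
  assumes "inj (\<lambda>j. column j X)" and "independent (columns X)"
  shows "inj ((*v) X)"
proof -
  have "columns X = range (\<lambda>j. column j X)"
    by (auto simp: columns_def)
  then have "card (columns X) = CARD('n)"
    using assms(1) by (simp add: card_image)
  moreover have "dim (columns X) = card (columns X)"
    by (rule dim_eq_card_independent[OF assms(2)])
  ultimately have "rank X = CARD('n)"
    by (simp add: column_rank_def)
  then show ?thesis
    by (simp add: full_rank_injective)
qed

text \<open>The continuous quadratic form attains its minimum on the compact unit sphere, where it
  is positive; homogeneity of degree two carries the bound to all vectors.\<close>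

lemma positive_definite_bounded_below:
  fixes X :: "real^'n^'n"
  assumes "positive_definite X"
  obtains c where "c > 0" and "\<And>y. c * (norm y)\<^sup>2 \<le> y \<bullet> (X *v y)"
proof -
  have "continuous_on (sphere 0 1) (\<lambda>y. y \<bullet> (X *v y))"
    by (intro continuous_intros matrix_vector_mult_linear_continuous_on)
  moreover have "sphere (0::real^'n) 1 \<noteq> {}"
    by simp
  ultimately have "\<exists>y0\<in>sphere 0 1. \<forall>y\<in>sphere 0 1. y0 \<bullet> (X *v y0) \<le> y \<bullet> (X *v y)"
    by (intro continuous_attains_inf compact_sphere)
  then obtain y0 where y0: "y0 \<in> sphere 0 1"
    and min: "\<And>y. y \<in> sphere 0 1 \<Longrightarrow> y0 \<bullet> (X *v y0) \<le> y \<bullet> (X *v y)"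
    by blast
  define c where "c = y0 \<bullet> (X *v y0)"
  have "y0 \<noteq> 0"
    using y0 by auto
  then have "c > 0"
    using assms unfolding positive_definite_def c_def by blast
  moreover have "c * (norm y)\<^sup>2 \<le> y \<bullet> (X *v y)" for y
  proof (cases "y = 0")
    case False
    have "c \<le> (y /\<^sub>R norm y) \<bullet> (X *v (y /\<^sub>R norm y))"
      unfolding c_def using False by (intro min) simp
    also have "\<dots> = (y \<bullet> (X *v y)) / (norm y)\<^sup>2"
      by (simp add: matrix_vector_mult_scaleR power2_eq_square divide_inverse)
    finally show ?thesis
      using False by (simp add: field_simps)
  qed simp
  ultimately show ?thesis
    using that by blast
qed

text \<open>Coercivity replaces any spectral argument: for small \<alpha> the map
  \<open>y - \<alpha> *\<^sub>R (X *v y)\<close> shrinks the Euclidean norm by a fixed factor, so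
  the iteration contracts towards the solution of \<open>X *v \<theta>' = b\<close>.\<close>

lemma positive_definite_stable_iteration:
  fixes X :: "real^'n^'n"
  assumes "positive_definite X"
  shows "stable_iteration X b"
proof -
  obtain c where c: "c > 0" and lower: "\<And>y. c * (norm y)\<^sup>2 \<le> y \<bullet> (X *v y)"
    using positive_definite_bounded_below[OF assms] by blast
  \<comment> \<open>Adding 1 makes \<open>K\<close> positive at once, so that
    \<open>c / K\<^sup>2\<close> is a legitimate upper bound for the step size.\<close>
  define K where "K = onorm ((*v) X) + 1"
  have upper: "norm (X *v y) \<le> K * norm y" for y
  proof -
    have "norm (X *v y) \<le> onorm ((*v) X) * norm y"
      by (intro onorm matrix_vector_mul_bounded_linear)
    also have "\<dots> \<le> K * norm y"
      unfolding K_def by (intro mult_right_mono) auto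
    finally show ?thesis .
  qed
  have K: "K > 0"
    using onorm_pos_le[OF matrix_vector_mul_bounded_linear, of X] by (simp add: K_def)
  have "inj ((*v) X)"
  proof (rule injI)
    fix x y assume "X *v x = X *v y"
    then have "X *v (x - y) = 0"
      by (simp add: matrix_vector_mult_diff_distrib)
    then have "c * (norm (x - y))\<^sup>2 \<le> 0"
      using lower[of "x - y"] by simp
    then show "x = y"
      using c by (simp add: mult_le_0_iff)
  qed
  then have "surj ((*v) X)"
    using linear_injective_imp_surjective[OF matrix_vector_mul_linear] by blast
  then obtain \<theta>' where \<theta>': "X *v \<theta>' = b"
    by (auto dest: surjD[of _ b])
  have contraction: "\<exists>r. 0 \<le> r \<and> r < 1 \<and> (\<forall>y. norm (y - \<alpha> *\<^sub>R (X *v y)) \<le> r * norm y)"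
    if \<alpha>: "0 < \<alpha>" "\<alpha> < c / K\<^sup>2" for \<alpha>
  proof -
    \<comment> \<open>This is the factor obtained by expanding the squared norm and inserting
      \<open>lower\<close> and \<open>upper\<close>. For \<alpha> below \<open>c / K\<^sup>2\<close>
      the quadratic term is less than \<open>\<alpha> * c\<close>, hence
      \<open>a < 1\<close>.\<close>
    define a where "a = 1 - 2 * \<alpha> * c + \<alpha>\<^sup>2 * K\<^sup>2"
    have bound: "(norm (y - \<alpha> *\<^sub>R (X *v y)))\<^sup>2 \<le> a * (norm y)\<^sup>2" for y
    proof -
      have "(norm (X *v y))\<^sup>2 \<le> K\<^sup>2 * (norm y)\<^sup>2"
        using power_mono[OF upper[of y], of 2] by (simp add: power_mult_distrib)
      then have "\<alpha>\<^sup>2 * (norm (X *v y))\<^sup>2 \<le> \<alpha>\<^sup>2 * (K\<^sup>2 * (norm y)\<^sup>2)"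
        by (intro mult_left_mono) auto
      moreover have "2 * \<alpha> * (c * (norm y)\<^sup>2) \<le> 2 * \<alpha> * (y \<bullet> (X *v y))"
        using lower[of y] \<alpha> by (intro mult_left_mono) auto
      moreover have "(norm (y - \<alpha> *\<^sub>R (X *v y)))\<^sup>2 =
          (norm y)\<^sup>2 - 2 * \<alpha> * (y \<bullet> (X *v y)) + \<alpha>\<^sup>2 * (norm (X *v y))\<^sup>2"
        unfolding power2_norm_eq_inner
        by (simp add: inner_diff inner_commute power2_eq_square algebra_simps)
      ultimately show ?thesis
        by (simp add: a_def algebra_simps)
    qed
    have "\<alpha> * K\<^sup>2 < c"
      using \<alpha> K by (simp add: field_simps)
    then have "\<alpha> * (\<alpha> * K\<^sup>2) < \<alpha> * c"
      using \<alpha> by simp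
    then have "a < 1"
      using \<alpha> c mult_pos_pos[of \<alpha> c] by (simp add: a_def power2_eq_square algebra_simps)
    \<comment> \<open>Evaluating \<open>bound\<close> at a unit vector places a square below
      \<open>a\<close>.\<close>
    moreover have "0 \<le> a"
      using order_trans[OF zero_le_power2 bound[of "axis undefined 1"]] by (simp add: norm_axis_1)
    moreover have "norm (y - \<alpha> *\<^sub>R (X *v y)) \<le> sqrt a * norm y" for y
      using real_sqrt_le_mono[OF bound[of y]] by (simp add: real_sqrt_mult)
    ultimately show ?thesis
      by (intro exI[of _ "sqrt a"]) auto
  qed
  have "\<forall>\<^sub>F \<alpha> in at_right (0::real). 0 < \<alpha> \<and> \<alpha> < c / K\<^sup>2"
    using c K eventually_at_right_real[of 0 "c / K\<^sup>2"] by simp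
  then show ?thesis
    unfolding stable_iteration_def
  proof (rule eventually_mono, intro exI[of _ \<theta>'] conjI allI)
    fix \<alpha> :: real and \<theta> assume \<alpha>: "0 < \<alpha> \<and> \<alpha> < c / K\<^sup>2"
    have "\<theta> + \<alpha> *\<^sub>R (b - X *v \<theta>) = \<theta> \<longleftrightarrow> X *v \<theta> = X *v \<theta>'"
      using \<alpha> \<theta>' by auto
    also have "\<dots> \<longleftrightarrow> \<theta> = \<theta>'"
      using \<open>inj ((*v) X)\<close> by (simp add: inj_eq)
    finally show "\<theta> + \<alpha> *\<^sub>R (b - X *v \<theta>) = \<theta> \<longleftrightarrow> \<theta> = \<theta>'" .
  next
    fix \<alpha> :: real and \<theta>\<^sub>0 assume "0 < \<alpha> \<and> \<alpha> < c / K\<^sup>2"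
    then obtain r where r: "0 \<le> r" "r < 1"
      and contr: "\<And>y. norm (y - \<alpha> *\<^sub>R (X *v y)) \<le> r * norm y"
      using contraction by blast
    define T where "T = (\<lambda>\<theta>. \<theta> + \<alpha> *\<^sub>R (b - X *v \<theta>))"
    have step: "norm (T \<theta> - \<theta>') \<le> r * norm (\<theta> - \<theta>')" for \<theta>
    proof -
      have "norm (T \<theta> - \<theta>') = norm ((\<theta> - \<theta>') - \<alpha> *\<^sub>R (X *v (\<theta> - \<theta>')))"
        by (intro arg_cong[where f = norm])
           (simp add: T_def matrix_vector_mult_diff_distrib \<theta>' scaleR_diff_right)
      also have "\<dots> \<le> r * norm (\<theta> - \<theta>')"
        by (rule contr)
      finally show ?thesis .
    qed
    have "norm ((T ^^ t) \<theta>\<^sub>0 - \<theta>') \<le> r ^ t * norm (\<theta>\<^sub>0 - \<theta>')" for t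
    proof (induction t)
      case (Suc t)
      have "norm ((T ^^ Suc t) \<theta>\<^sub>0 - \<theta>') \<le> r * norm ((T ^^ t) \<theta>\<^sub>0 - \<theta>')"
        using step by simp
      also have "\<dots> \<le> r * (r ^ t * norm (\<theta>\<^sub>0 - \<theta>'))"
        using r Suc.IH by (intro mult_left_mono)
      finally show ?case by simp
    qed simp
    moreover have "(\<lambda>t. r ^ t * norm (\<theta>\<^sub>0 - \<theta>')) \<longlonglongrightarrow> 0"
      using r by (intro tendsto_mult_left_zero LIMSEQ_realpow_zero)
    ultimately have "(\<lambda>t. (T ^^ t) \<theta>\<^sub>0 - \<theta>') \<longlonglongrightarrow> 0"
      by (rule Lim_null_comparison[OF always_eventually[OF allI]])
    then have "(\<lambda>t. (T ^^ t) \<theta>\<^sub>0) \<longlonglongrightarrow> \<theta>'"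
      by (rule LIM_zero_cancel)
    then show "(\<lambda>t. ((\<lambda>\<theta>. \<theta> + \<alpha> *\<^sub>R (b - X *v \<theta>)) ^^ t) \<theta>\<^sub>0) \<longlonglongrightarrow> \<theta>'"
      unfolding T_def .
  qed
qed

text \<open>Multiplying \<open>2 * u * v \<le> u\<^sup>2 + v\<^sup>2\<close> by the nonpositive
  off-diagonal entries bounds the form from below by a sum of squares, in which
  \<open>(y $ s)\<^sup>2\<close> has as weight half the sum of the row and column sums at
  \<open>s\<close>. These weights are positive.\<close>

lemma positive_definite_diagonally_dominant:
  fixes X :: "real^'s^'s"
  assumes off_diagonal: "\<And>s s'. s \<noteq> s' \<Longrightarrow> X $ s $ s' \<le> 0"
    and row_sum: "\<And>s. (\<Sum>s'\<in>UNIV. X $ s $ s') \<ge> 0"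
    and column_sum: "\<And>s'. (\<Sum>s\<in>UNIV. X $ s $ s') > 0"
  shows "positive_definite X"
  unfolding positive_definite_def
proof (intro allI impI)
  fix y :: "real^'s" assume "y \<noteq> 0"
  then obtain j where j: "y $ j \<noteq> 0"
    by (auto simp: vec_eq_iff)
  have entry: "X $ s $ s' * ((y $ s)\<^sup>2 + (y $ s')\<^sup>2) / 2 \<le> y $ s * (X $ s $ s' * y $ s')" for s s'
  proof (cases "s = s'")
    case True
    then show ?thesis by (simp add: power2_eq_square)
  next
    case False
    have "2 * (y $ s * y $ s') \<le> (y $ s)\<^sup>2 + (y $ s')\<^sup>2"
      using sum_squares_bound[of "y $ s" "y $ s'"] by (simp add: mult.assoc)
    from mult_left_mono_neg[OF this off_diagonal[OF False]] show ?thesis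
      by (simp add: mult_ac)
  qed
  let ?r = "\<lambda>s. \<Sum>s'\<in>UNIV. X $ s $ s'" and ?c = "\<lambda>s'. \<Sum>s\<in>UNIV. X $ s $ s'"
  have "0 < (\<Sum>s\<in>UNIV. (?r s + ?c s) * (y $ s)\<^sup>2 / 2)"
  proof (rule sum_pos2[of _ j])
    show "0 < (?r j + ?c j) * (y $ j)\<^sup>2 / 2"
      using j row_sum[of j] column_sum[of j] by simp
    show "0 \<le> (?r s + ?c s) * (y $ s)\<^sup>2 / 2" for s
      using row_sum[of s] column_sum[of s] by (simp add: less_imp_le)
  qed auto
  also have "\<dots> = (\<Sum>s\<in>UNIV. \<Sum>s'\<in>UNIV. X $ s $ s' * (y $ s)\<^sup>2 / 2)
      + (\<Sum>s'\<in>UNIV. \<Sum>s\<in>UNIV. X $ s $ s' * (y $ s')\<^sup>2 / 2)"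
    by (simp add: distrib_right add_divide_distrib sum.distrib sum_distrib_right sum_divide_distrib)
  \<comment> \<open>The column part is summed in the opposite order; after a swap the two double
    sums merge entry by entry.\<close>
  also have "\<dots> = (\<Sum>s\<in>UNIV. \<Sum>s'\<in>UNIV. X $ s $ s' * ((y $ s)\<^sup>2 + (y $ s')\<^sup>2) / 2)"
    by (subst (2) sum.swap) (simp add: distrib_left add_divide_distrib sum.distrib)
  also have "\<dots> \<le> (\<Sum>s\<in>UNIV. \<Sum>s'\<in>UNIV. y $ s * (X $ s $ s' * y $ s'))"
    by (intro sum_mono entry)
  also have "\<dots> = y \<bullet> (X *v y)"
    by (simp add: inner_vec_def matrix_vector_mult_def sum_distrib_left)
  finally show "0 < y \<bullet> (X *v y)" .
qed

lemma positive_definite_congruence: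
  fixes X :: "real^'s^'s" and Y :: "real^'n^'s"
  assumes "positive_definite X" and "inj ((*v) Y)"
  shows "positive_definite (transpose Y ** X ** Y)"
  unfolding positive_definite_def
proof (intro allI impI)
  fix y :: "real^'n" assume "y \<noteq> 0"
  then have "Y *v y \<noteq> 0"
    using injD[OF assms(2), of y 0] by auto
  then have "0 < (Y *v y) \<bullet> (X *v (Y *v y))"
    using assms(1) by (simp add: positive_definite_def)
  also have "\<dots> = y \<bullet> ((transpose Y ** X ** Y) *v y)"
    by (simp add: matrix_vector_mul_assoc[symmetric] inner_commute[of y] dot_lmul_matrix)
       (simp add: inner_commute)
  finally show "0 < y \<bullet> ((transpose Y ** X ** Y) *v y)" .
qed

section \<open>Neumann series of nonnegative matrices\<close>

lemma matrix_mult_diag [simp]: "(X ** diag_matrix f) $ s $ s' = X $ s $ s' * f s'"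
  by (simp add: matrix_matrix_mult_def diag_matrix_def if_distrib cong: if_cong)

lemma diag_matrix_mult [simp]: "(diag_matrix f ** X) $ s $ s' = f s * X $ s $ s'"
  by (simp add: matrix_matrix_mult_def diag_matrix_def if_distrib if_distribR cong: if_cong)

lemma transpose_matrix_mult_nth:
  fixes X :: "real^'n^'m"
  shows "(transpose X ** Y) $ j $ k = (\<Sum>s\<in>UNIV. X $ s $ j * Y $ s $ k)"
  by (simp add: matrix_matrix_mult_def transpose_def)

lemma matrix_mult_nonneg:
  fixes X :: "real^'n^'m" and Y :: "real^'k^'n"
  assumes "\<And>s r. X $ s $ r \<ge> 0" and "\<And>r s'. Y $ r $ s' \<ge> 0"
  shows "(X ** Y) $ s $ s' \<ge> 0"
  by (simp add: matrix_matrix_mult_def sum_nonneg assms)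

lemma row_sum_matrix_mult:
  fixes X :: "real^'n^'m" and Y :: "real^'k^'n"
  shows "(\<Sum>s'\<in>UNIV. (X ** Y) $ s $ s') = (\<Sum>r\<in>UNIV. X $ s $ r * (\<Sum>s'\<in>UNIV. Y $ r $ s'))"
  unfolding matrix_matrix_mult_def by (simp add: sum_distrib_left) (rule sum.swap)

text \<open>\<open>matrix_power\<close> adds new factors on the left; telescoping the Neumann series
  needs them on the right.\<close>

lemma matrix_power_commute: "matrix_power X k ** X = X ** matrix_power X k"
  by (induction k) (simp_all add: matrix_mul_assoc[symmetric])

lemma matrix_power_nonneg:
  assumes "\<And>s s'. X $ s $ s' \<ge> 0"
  shows "matrix_power X k $ s $ s' \<ge> 0"
proof (induction k arbitrary: s s')
  case (Suc k)
  then show ?case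
    by (auto simp: matrix_matrix_mult_def assms intro!: sum_nonneg)
qed (simp add: mat_def)

lemma matrix_diff_ldistrib: "(X :: real^'n^'m) ** (Y - Z) = X ** Y - X ** Z"
  by (simp add: vec_eq_iff matrix_matrix_mult_def right_diff_distrib sum_subtractf)

lemma matrix_diff_rdistrib: "((Y :: real^'n^'m) - Z) ** X = Y ** X - Z ** X"
  by (simp add: vec_eq_iff matrix_matrix_mult_def left_diff_distrib sum_subtractf)

lemma bounded_linear_matrix_mult_right: "bounded_linear (\<lambda>X. (X :: real^'n^'m) ** Y)"
  by (rule linear_conv_bounded_linear[THEN iffD1])
     (simp add: linear_iff vec_eq_iff matrix_matrix_mult_def distrib_right sum.distrib
       sum_distrib_left mult.assoc)

text \<open>Allows a matrix series to be summed entrywise, where comparison with a real geometric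
  series is available.\<close>

lemma matrix_sums_iff:
  fixes F :: "nat \<Rightarrow> real^'n^'m"
  shows "F sums X \<longleftrightarrow> (\<forall>s s'. (\<lambda>k. F k $ s $ s') sums (X $ s $ s'))"
proof
  assume "F sums X"
  then show "\<forall>s s'. (\<lambda>k. F k $ s $ s') sums (X $ s $ s')"
    unfolding sums_def
    by (auto simp flip: sum_component intro!: tendsto_vec_nth)
next
  assume "\<forall>s s'. (\<lambda>k. F k $ s $ s') sums (X $ s $ s')"
  then show "F sums X"
    unfolding sums_def by (intro vec_tendstoI) simp
qed

text \<open>Since \<open>f\<close> dominates \<open>f v* X\<close> strictly, \<open>X\<close> is a contraction in the \<open>f\<close>-weighted row norm.\<close>

lemma matrix_power_geometric_bound:
  fixes X :: "real^'s^'s" and f :: "real^'s"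
  assumes nonneg: "\<And>s s'. X $ s $ s' \<ge> 0"
    and pos: "\<And>s. f $ s > 0"
    and super: "\<And>s. (f v* X) $ s < f $ s"
  obtains c where "0 \<le> c" "c < 1" "\<And>k s s'. matrix_power X k $ s $ s' \<le> c ^ k * (f $ s' / f $ s)"
proof -
  \<comment> \<open>The contraction factor is the worst ratio over the finitely many states; each
    ratio is below 1 by \<open>super\<close>, hence so is the maximum.\<close>
  define c where "c = Max (range (\<lambda>s. (f v* X) $ s / f $ s))"
  have le_c: "(f v* X) $ s / f $ s \<le> c" for s
    by (simp add: c_def)
  have nonneg': "(f v* X) $ s \<ge> 0" for s
    by (auto simp: vector_matrix_mult_def intro!: sum_nonneg mult_nonneg_nonneg nonneg less_imp_le[OF pos])
  have "c \<ge> 0"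
    using order_trans[OF divide_nonneg_pos[OF nonneg' pos] le_c] .
  moreover have "c < 1"
    using super pos by (simp add: c_def)
  moreover have step: "(f v* X) $ s \<le> c * f $ s" for s
    using le_c[of s] pos[of s] by (simp add: pos_divide_le_eq)
  have power: "(f v* matrix_power X k) $ s \<le> c ^ k * f $ s" for k s
  proof (induction k arbitrary: s)
    case (Suc k)
    have "(f v* matrix_power X (Suc k)) $ s = ((f v* X) v* matrix_power X k) $ s"
      by (simp add: vector_matrix_mul_assoc)
    also have "\<dots> = (\<Sum>s'\<in>UNIV. matrix_power X k $ s' $ s * (f v* X) $ s')"
      by (simp add: vector_matrix_mult_def mult.commute)
    also have "\<dots> \<le> (\<Sum>s'\<in>UNIV. matrix_power X k $ s' $ s * (c * f $ s'))"
      by (intro sum_mono mult_left_mono step matrix_power_nonneg nonneg)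
    also have "\<dots> = c * (f v* matrix_power X k) $ s"
      by (simp add: vector_matrix_mult_def sum_distrib_left mult_ac)
    also have "\<dots> \<le> c * (c ^ k * f $ s)"
      using \<open>c \<ge> 0\<close> Suc.IH by (intro mult_left_mono)
    finally show ?case by simp
  qed (simp add: vector_matrix_mult_def mat_def if_distrib sum.If_cases cong: if_cong)
  \<comment> \<open>All terms of the sum defining \<open>(f v* matrix_power X k) $ s'\<close> are
    nonnegative, so the single term at \<open>s\<close> is bounded by the whole; division by
    \<open>f $ s\<close> isolates the entry.\<close>
  have "matrix_power X k $ s $ s' \<le> c ^ k * (f $ s' / f $ s)" for k s s'
  proof -
    have "f $ s * matrix_power X k $ s $ s' \<le> (f v* matrix_power X k) $ s'"
      unfolding vector_matrix_mult_def vec_lambda_beta mult.commute[of "matrix_power X k $ _ $ s'"]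
      by (rule member_le_sum[where f = "\<lambda>s. f $ s * matrix_power X k $ s $ s'"])
         (auto intro!: mult_nonneg_nonneg matrix_power_nonneg nonneg less_imp_le[OF pos])
    with power[of k s'] pos[of s] show ?thesis
      by (simp add: field_simps)
  qed
  ultimately show ?thesis
    using that by blast
qed

text \<open>The geometric bound makes every entry of the series summable, and the sum inherits
  nonnegativity from the powers.\<close>

lemma neumann_series:
  fixes X :: "real^'s^'s" and f :: "real^'s"
  assumes nonneg: "\<And>s s'. X $ s $ s' \<ge> 0"
    and pos: "\<And>s. f $ s > 0"
    and super: "\<And>s. (f v* X) $ s < f $ s"
  obtains N where "matrix_power X sums N" "\<And>s s'. N $ s $ s' \<ge> 0"
    "N ** (mat 1 - X) = mat 1" "(mat 1 - X) ** N = mat 1"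
proof -
  obtain c where c: "0 \<le> c" "c < 1"
    and bound: "\<And>k s s'. matrix_power X k $ s $ s' \<le> c ^ k * (f $ s' / f $ s)"
    using matrix_power_geometric_bound[OF assms] by blast
  have geometric: "summable (\<lambda>k. c ^ k * (f $ s' / f $ s))" for s s'
    using c by (intro summable_mult2 summable_geometric) simp
  have summable: "summable (\<lambda>k. matrix_power X k $ s $ s')" for s s'
    by (rule summable_comparison_test'[OF geometric[of s' s]])
       (simp only: real_norm_def abs_of_nonneg matrix_power_nonneg nonneg bound)
  define N where "N = (\<chi> s s'. \<Sum>k. matrix_power X k $ s $ s')"
  have sums: "matrix_power X sums N"
    unfolding matrix_sums_iff by (simp add: N_def summable_sums[OF summable])
  moreover have "N $ s $ s' \<ge> 0" for s s'
    by (simp add: N_def suminf_nonneg summable matrix_power_nonneg nonneg)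
  moreover have inverse: "N ** (mat 1 - X) = mat 1"
  proof (rule sums_unique2)
    show "(\<lambda>k. matrix_power X k ** (mat 1 - X)) sums (N ** (mat 1 - X))"
      by (rule bounded_linear.sums[OF bounded_linear_matrix_mult_right sums])
    \<comment> \<open>Multiplied by \<open>mat 1 - X\<close>, the series telescopes to the zeroth
      power minus the limit of the powers, which is 0 by convergence of the series.\<close>
    have "matrix_power X \<longlonglongrightarrow> 0"
      using sums by (intro summable_LIMSEQ_zero sums_summable)
    then have "(\<lambda>k. matrix_power X k - matrix_power X (Suc k)) sums (matrix_power X 0 - 0)"
      by (rule telescope_sums')
    then show "(\<lambda>k. matrix_power X k ** (mat 1 - X)) sums mat 1"
      by (simp add: matrix_diff_ldistrib matrix_power_commute)
  qed
  moreover have "(mat 1 - X) ** N = mat 1"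
    using inverse by (simp add: matrix_left_right_inverse)
  ultimately show ?thesis
    using that by blast
qed

section \<open>Integrals along a trajectory\<close>

text \<open>Holds on null events too: the integral vanishes almost everywhere there, and the factor
  \<open>measure N B\<close> is 0.\<close>

lemma set_integral_eq_expectation_given:
  fixes X :: "'w \<Rightarrow> 'b::euclidean_space"
  assumes "B \<in> sets N" and "emeasure N B \<noteq> \<infinity>"
  shows "(LINT \<omega>:B|N. X \<omega>) = measure N B *\<^sub>R expectation_given N X B"
proof (cases "measure N B = 0")
  case True
  then have "B \<in> null_sets N"
    using assms by (auto simp: measure_eq_0_null_sets null_sets_def measure_def enn2real_eq_0_iff)
  then have "AE \<omega> in N. indicator B \<omega> *\<^sub>R X \<omega> = 0"
    using AE_not_in by fastforce
  then have "(LINT \<omega>:B|N. X \<omega>) = 0"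
    unfolding set_lebesgue_integral_def by (rule integral_eq_zero_AE)
  with True show ?thesis
    by simp
next
  case False
  then show ?thesis
    by (simp add: expectation_given_def)
qed

text \<open>Only the level set containing \<omega> contributes. Integrals against a vector-valued
  simple function thus reduce to finitely many real integrals of \<open>g\<close> over level
  sets.\<close>

lemma simple_function_decomposition:
  fixes G :: "'w \<Rightarrow> 'b::real_vector"
  assumes "simple_function N G" and "\<omega> \<in> space N"
  shows "g \<omega> *\<^sub>R G \<omega> = (\<Sum>v\<in>G ` space N. (indicator (G -` {v} \<inter> space N) \<omega> * g \<omega>) *\<^sub>R v)"
proof -
  have "(\<Sum>v\<in>G ` space N. (indicator (G -` {v} \<inter> space N) \<omega> * g \<omega>) *\<^sub>R v) =
      (\<Sum>v\<in>G ` space N. if v = G \<omega> then g \<omega> *\<^sub>R v else 0)"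
    using assms(2) by (intro sum.cong) (auto simp: indicator_def)
  then show ?thesis
    using assms by (simp add: simple_function_def)
qed

lemma integrable_scaleR_simple_function:
  fixes G :: "'w \<Rightarrow> 'b::{banach, second_countable_topology}" and g :: "'w \<Rightarrow> real"
  assumes G: "simple_function N G" and g: "integrable N g"
  shows "integrable N (\<lambda>\<omega>. g \<omega> *\<^sub>R G \<omega>)"
proof -
  have "integrable N (\<lambda>\<omega>. \<Sum>v\<in>G ` space N. (indicator (G -` {v} \<inter> space N) \<omega> *\<^sub>R g \<omega>) *\<^sub>R v)"
    using G by (intro Bochner_Integration.integrable_sum integrable_scaleR_left
        integrable_mult_indicator g simple_functionD)
  then show ?thesis
    by (rule Bochner_Integration.integrable_cong[THEN iffD1, rotated 2])
       (simp_all add: simple_function_decomposition[OF G])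
qed

lemma integral_scaleR_simple_function:
  fixes G :: "'w \<Rightarrow> 'b::{banach, second_countable_topology}" and g :: "'w \<Rightarrow> real"
  assumes G: "simple_function N G" and g: "integrable N g"
  shows "(\<integral>\<omega>. g \<omega> *\<^sub>R G \<omega> \<partial>N) =
    (\<Sum>v\<in>G ` space N. (\<integral>\<omega>. indicator (G -` {v} \<inter> space N) \<omega> * g \<omega> \<partial>N) *\<^sub>R v)"
proof -
  have int: "integrable N (\<lambda>\<omega>. indicator (G -` {v} \<inter> space N) \<omega> * g \<omega>)" for v
    using integrable_mult_indicator[OF simple_functionD(2)[OF G] g, of "{v}"] by simp
  have "(\<integral>\<omega>. g \<omega> *\<^sub>R G \<omega> \<partial>N) =
      (\<integral>\<omega>. (\<Sum>v\<in>G ` space N. (indicator (G -` {v} \<inter> space N) \<omega> * g \<omega>) *\<^sub>R v) \<partial>N)"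
    by (intro Bochner_Integration.integral_cong refl simple_function_decomposition[OF G])
  also have "\<dots> = (\<Sum>v\<in>G ` space N. (\<integral>\<omega>. indicator (G -` {v} \<inter> space N) \<omega> * g \<omega> \<partial>N) *\<^sub>R v)"
    by (subst Bochner_Integration.integral_sum) (simp_all add: int)
  finally show ?thesis .
qed

section \<open>The sigma-algebra of the past\<close>

context behavior_trajectory
begin

text \<open>Packages \<open>history\<close> as a measure space so that
  \<open>simple_function\<close> can express dependence on the past. Only its space and its sets
  matter; the measure it carries is zero.\<close>

definition past :: "nat \<Rightarrow> 'w measure" where
  "past t = sigma (space M)
     ((\<Union>k\<in>{..t}. {S k -` X \<inter> space M |X. True}) \<union>
      (\<Union>k\<in>{..<t}. {A k -` X \<inter> space M |X. True}) \<union>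
      (\<Union>k\<in>{1..t}. {R k -` B \<inter> space M |B. B \<in> sets borel}))"

abbreviation state_event :: "nat \<Rightarrow> 's \<Rightarrow> 'w set" where
  "state_event t s \<equiv> {\<omega> \<in> space M. S t \<omega> = s}"

abbreviation state_action_event :: "nat \<Rightarrow> 's \<Rightarrow> 'a \<Rightarrow> 'w set" where
  "state_action_event t s a \<equiv> {\<omega> \<in> space M. S t \<omega> = s \<and> A t \<omega> = a}"

lemma space_past [simp]: "space (past t) = space M"
  unfolding past_def by (intro space_measure_of) auto

lemma sets_past: "sets (past t) = history M S A R t"
  unfolding past_def history_def by (intro sets_measure_of) auto

lemma sets_past_subset: "sets (past t) \<subseteq> sets M"
proof -
  \<comment> \<open>Integrability is assumed for \<open>R (Suc t)\<close>, so a reward index of at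
    least 1 is read as the successor of \<open>k - 1\<close>.\<close>
  have "R k \<in> borel_measurable M" if "k \<in> {1..t}" for k
    using that reward_integrable[of "k - 1"] by (auto intro: borel_measurable_integrable)
  then have "(\<Union>k\<in>{..t}. {S k -` X \<inter> space M |X. True}) \<union>
      (\<Union>k\<in>{..<t}. {A k -` X \<inter> space M |X. True}) \<union>
      (\<Union>k\<in>{1..t}. {R k -` B \<inter> space M |B. B \<in> sets borel}) \<subseteq> sets M"
    by (auto intro!: measurable_sets[OF state_measurable] measurable_sets[OF action_measurable]
        measurable_sets)
  then show ?thesis
    unfolding sets_past history_def by (rule sets.sigma_sets_subset)
qed

lemma sets_past_mono: "t \<le> t' \<Longrightarrow> sets (past t) \<subseteq> sets (past t')"
  unfolding sets_past history_def by (intro sigma_sets_mono' Un_mono UN_mono) auto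

lemma simple_function_past_mono:
  "simple_function (past t) G \<Longrightarrow> t \<le> t' \<Longrightarrow> simple_function (past t') G"
  using sets_past_mono[of t t'] by (auto simp: simple_function_def)

lemma simple_function_past: "simple_function (past t) G \<Longrightarrow> simple_function M G"
  using sets_past_subset[of t] by (auto simp: simple_function_def)

lemma simple_function_state: "simple_function (past t) (S t)"
proof -
  have "S t -` X \<inter> space M \<in> sets (past t)" for X
    unfolding sets_past history_def by (rule sigma_sets.Basic) blast
  then show ?thesis
    by (simp add: simple_function_def)
qed

text \<open>The history at \<open>t\<close> ends before the action at \<open>t\<close> is drawn, so
  \<open>A t\<close> belongs to the past only from \<open>Suc t\<close> on, whereas
  \<open>S t\<close> already does at \<open>t\<close>.\<close>

lemma simple_function_action: "simple_function (past (Suc t)) (A t)"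
proof -
  have "A t -` X \<inter> space M \<in> sets (past (Suc t))" for X
    unfolding sets_past history_def by (rule sigma_sets.Basic) blast
  then show ?thesis
    by (simp add: simple_function_def)
qed

lemma state_event_sets [measurable]: "state_event t s \<in> sets M"
  using measurable_sets[OF state_measurable, of "{s}" t] by (simp add: vimage_def Int_def conj_commute)

lemma state_action_event_sets [measurable]: "state_action_event t s a \<in> sets M"
proof -
  have "state_action_event t s a = (S t -` {s} \<inter> space M) \<inter> (A t -` {a} \<inter> space M)"
    by auto
  then show ?thesis
    using measurable_sets[OF state_measurable, of "{s}" t]
      measurable_sets[OF action_measurable, of "{a}" t] by simp
qed

section \<open>Conditional laws of action and successor as integral identities\<close>

lemma measurable_successor:
  "(\<lambda>\<omega>. (R (Suc t) \<omega>, S (Suc t) \<omega>)) \<in> measurable M (borel \<Otimes>\<^sub>M count_space UNIV)"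
  using reward_integrable[of t] state_measurable[of "Suc t"]
  by (intro measurable_Pair) (auto intro: borel_measurable_integrable)

text \<open>In the product form of \<open>transition_law\<close>, the successor pair pushes the
  restriction of \<open>M\<close> to the event forward to a multiple of \<open>q s a\<close>.
  Integrating \<open>h\<close> against these equal measures gives the claim.\<close>

lemma integral_transition_event:
  fixes h :: "real \<times> 's \<Rightarrow> real"
  assumes E: "E \<in> sets (past t)" and h: "h \<in> borel_measurable (borel \<Otimes>\<^sub>M count_space UNIV)"
  shows "(\<integral>\<omega>. indicator (E \<inter> state_action_event t s a) \<omega> * h (R (Suc t) \<omega>, S (Suc t) \<omega>) \<partial>M)
    = measure M (E \<inter> state_action_event t s a) * (\<integral>x. h x \<partial>q s a)"
proof -
  let ?X = "\<lambda>\<omega>. (R (Suc t) \<omega>, S (Suc t) \<omega>)" and ?N = "borel \<Otimes>\<^sub>M count_space UNIV"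
  define E' where "E' = E \<inter> state_action_event t s a"
  have E'_alt: "E' = {\<omega> \<in> E. S t \<omega> = s \<and> A t \<omega> = a}"
    using sets.sets_into_space[OF E] by (auto simp: E'_def)
  have E'_sets [measurable]: "E' \<in> sets M"
    using E sets_past_subset[of t] by (auto simp: E'_def)
  interpret q: prob_space "q s a"
    by (rule kernel_prob)
  have X: "?X \<in> measurable (restrict_space M E') ?N"
    by (intro measurable_restrict_space1 measurable_successor)
  have "distr (restrict_space M E') ?N ?X = density (q s a) (\<lambda>_. ennreal (measure M E'))"
  proof (rule measure_eqI)
    fix B assume "B \<in> sets (distr (restrict_space M E') ?N ?X)"
    then have B: "B \<in> sets ?N"
      by simp
    have "emeasure (distr (restrict_space M E') ?N ?X) B =
        emeasure (restrict_space M E') (?X -` B \<inter> space (restrict_space M E'))"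
      using B by (intro emeasure_distr X)
    also have "?X -` B \<inter> space (restrict_space M E') =
        {\<omega> \<in> E. S t \<omega> = s \<and> A t \<omega> = a \<and> ?X \<omega> \<in> B}"
      using sets.sets_into_space[OF E] by (auto simp: E'_alt space_restrict_space)
    also have "emeasure (restrict_space M E') \<dots> = emeasure M \<dots>"
    proof (rule emeasure_restrict_space)
      show "E' \<inter> space M \<in> sets M"
        by simp
    qed (auto simp: E'_alt)
    also have "\<dots> = ennreal (measure M E' * measure (q s a) B)"
      using transition_law[OF E[unfolded sets_past] B, of s a]
      by (simp add: emeasure_eq_measure E'_alt)
    also have "\<dots> = emeasure (density (q s a) (\<lambda>_. ennreal (measure M E'))) B"
      using B kernel_sets[of s a]
      by (simp add: emeasure_density_const q.emeasure_eq_measure ennreal_mult)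
    finally show "emeasure (distr (restrict_space M E') ?N ?X) B =
        emeasure (density (q s a) (\<lambda>_. ennreal (measure M E'))) B" .
  qed (simp add: kernel_sets)
  then have "integral\<^sup>L (distr (restrict_space M E') ?N ?X) h =
      integral\<^sup>L (density (q s a) (\<lambda>_. ennreal (measure M E'))) h"
    by simp
  moreover have "integral\<^sup>L (distr (restrict_space M E') ?N ?X) h =
      (\<integral>\<omega>. indicator E' \<omega> * h (?X \<omega>) \<partial>M)"
    by (simp add: integral_distr[OF X h] integral_restrict_space)
  moreover have "integral\<^sup>L (density (q s a) (\<lambda>_. ennreal (measure M E'))) h =
      measure M E' * (\<integral>x. h x \<partial>q s a)"
    using h measurable_cong_sets[OF kernel_sets refl] by (subst integral_density) auto
  ultimately show ?thesis
    by (simp add: E'_def)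
qed

text \<open>Each level set of \<open>G\<close> is an event of the past, so
  \<open>integral_transition_event\<close> splits off the integral of \<open>h\<close> on it; the
  finitely many level sets are then summed up again.\<close>

lemma set_integral_transition:
  fixes G :: "'w \<Rightarrow> 'b::{banach, second_countable_topology}" and h :: "real \<times> 's \<Rightarrow> real"
  assumes G: "simple_function (past t) G"
    and h: "h \<in> borel_measurable (borel \<Otimes>\<^sub>M count_space UNIV)"
    and int: "integrable M (\<lambda>\<omega>. h (R (Suc t) \<omega>, S (Suc t) \<omega>))"
  shows "(LINT \<omega>:state_action_event t s a|M. h (R (Suc t) \<omega>, S (Suc t) \<omega>) *\<^sub>R G \<omega>)
    = (\<integral>x. h x \<partial>q s a) *\<^sub>R (LINT \<omega>:state_action_event t s a|M. G \<omega>)"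
proof -
  let ?E = "state_action_event t s a" and ?X = "\<lambda>\<omega>. (R (Suc t) \<omega>, S (Suc t) \<omega>)"
  have G': "simple_function M G"
    using G by (rule simple_function_past)
  have E: "G -` {v} \<inter> space M \<in> sets (past t)" for v
    using simple_functionD(2)[OF G, of "{v}"] by simp
  have E_space [simp]: "F \<inter> ?E \<inter> space M = F \<inter> ?E" for F
    by auto
  have "(LINT \<omega>:?E|M. h (?X \<omega>) *\<^sub>R G \<omega>) = (\<integral>\<omega>. (indicator ?E \<omega> * h (?X \<omega>)) *\<^sub>R G \<omega> \<partial>M)"
    by (simp add: set_lebesgue_integral_def)
  also have "\<dots> = (\<Sum>v\<in>G ` space M.
      (\<integral>\<omega>. indicator (G -` {v} \<inter> space M) \<omega> * (indicator ?E \<omega> * h (?X \<omega>)) \<partial>M) *\<^sub>R v)"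
    using integrable_mult_indicator[OF state_action_event_sets int]
    by (intro integral_scaleR_simple_function[OF G']) simp
  also have "\<dots> = (\<Sum>v\<in>G ` space M.
      (measure M ((G -` {v} \<inter> space M) \<inter> ?E) * (\<integral>x. h x \<partial>q s a)) *\<^sub>R v)"
    unfolding mult.assoc[symmetric] indicator_inter_arith[symmetric]
    by (simp only: integral_transition_event[OF E h])
  also have "\<dots> = (\<integral>x. h x \<partial>q s a) *\<^sub>R (\<Sum>v\<in>G ` space M.
      (\<integral>\<omega>. indicator (G -` {v} \<inter> space M) \<omega> * indicator ?E \<omega> \<partial>M) *\<^sub>R v)"
    using E sets_past_subset[of t]
    by (simp add: indicator_inter_arith[symmetric] scaleR_sum_right mult.commute subset_iff)
  also have "\<dots> = (\<integral>x. h x \<partial>q s a) *\<^sub>R (\<integral>\<omega>. indicator ?E \<omega> *\<^sub>R G \<omega> \<partial>M)"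
    by (subst integral_scaleR_simple_function[OF G']) (auto simp: less_top[symmetric])
  finally show ?thesis
    by (simp add: set_lebesgue_integral_def)
qed

text \<open>The same decomposition into level sets, now with \<open>action_law\<close> on each of
  them.\<close>

lemma set_integral_action:
  fixes G :: "'w \<Rightarrow> 'b::{banach, second_countable_topology}"
  assumes G: "simple_function (past t) G"
  shows "(LINT \<omega>:state_action_event t s a|M. G \<omega>) = pmf (\<mu> s) a *\<^sub>R (LINT \<omega>:state_event t s|M. G \<omega>)"
proof -
  have G': "simple_function M G"
    using G by (rule simple_function_past)
  have E: "G -` {v} \<inter> space M \<in> sets (past t)" for v
    using simple_functionD(2)[OF G, of "{v}"] by simp
  have law: "measure M (F \<inter> state_action_event t s a) = measure M (F \<inter> state_event t s) * pmf (\<mu> s) a"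
    if F: "F \<in> sets (past t)" for F
  proof -
    have "F \<inter> state_action_event t s a = {\<omega> \<in> F. S t \<omega> = s \<and> A t \<omega> = a}"
      "F \<inter> state_event t s = {\<omega> \<in> F. S t \<omega> = s}"
      using sets.sets_into_space[OF F] by auto
    then show ?thesis
      using action_law[OF F[unfolded sets_past]] by simp
  qed
  have sum: "(LINT \<omega>:B|M. G \<omega>) = (\<Sum>v\<in>G ` space M. measure M ((G -` {v} \<inter> space M) \<inter> B) *\<^sub>R v)"
    if B: "B \<in> sets M" for B
  proof -
    have "F \<inter> B \<inter> space M = F \<inter> B" for F
      using sets.sets_into_space[OF B] by auto
    then show ?thesis
      unfolding set_lebesgue_integral_def using B
      by (subst integral_scaleR_simple_function[OF G'])
         (auto simp: indicator_inter_arith[symmetric] less_top[symmetric])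
  qed
  show ?thesis
    by (simp add: sum law[OF E] scaleR_sum_right mult.commute)
qed

section \<open>Integrability and partition by states and actions\<close>

lemma integrable_past:
  fixes G :: "'w \<Rightarrow> 'b::{banach, second_countable_topology}"
  assumes "simple_function (past t) G"
  shows "integrable M G"
  using integrable_scaleR_simple_function[OF simple_function_past[OF assms], of "\<lambda>_. 1"] by simp

lemma set_integrable_of_integrable:
  fixes G :: "'w \<Rightarrow> 'b::{banach, second_countable_topology}"
  shows "integrable M G \<Longrightarrow> B \<in> sets M \<Longrightarrow> set_integrable M B G"
  unfolding set_integrable_def by (rule integrable_mult_indicator)

lemma set_integral_sum_states:
  fixes G :: "'w \<Rightarrow> 'b::{banach, second_countable_topology}"
  assumes "integrable M G" and "B \<in> sets M"
  shows "(LINT \<omega>:B|M. G \<omega>) = (\<Sum>s\<in>UNIV. LINT \<omega>:B \<inter> state_event t s|M. G \<omega>)"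
proof -
  have "B = (\<Union>s\<in>UNIV. B \<inter> state_event t s)"
    using sets.sets_into_space[OF assms(2)] by auto
  then have "(LINT \<omega>:B|M. G \<omega>) = (LINT \<omega>:(\<Union>s\<in>UNIV. B \<inter> state_event t s)|M. G \<omega>)"
    by simp
  also have "\<dots> = (\<Sum>s\<in>UNIV. LINT \<omega>:B \<inter> state_event t s|M. G \<omega>)"
    using assms by (intro set_integral_finite_Union set_integrable_of_integrable)
      (auto simp: disjoint_family_on_def)
  finally show ?thesis .
qed

lemma set_integral_sum_actions:
  fixes G :: "'w \<Rightarrow> 'b::{banach, second_countable_topology}"
  assumes "integrable M G"
  shows "(LINT \<omega>:state_event t s|M. G \<omega>) = (\<Sum>a\<in>UNIV. LINT \<omega>:state_action_event t s a|M. G \<omega>)"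
proof -
  have "state_event t s = (\<Union>a\<in>UNIV. state_action_event t s a)"
    by auto
  then have "(LINT \<omega>:state_event t s|M. G \<omega>) = (LINT \<omega>:(\<Union>a\<in>UNIV. state_action_event t s a)|M. G \<omega>)"
    by simp
  also have "\<dots> = (\<Sum>a\<in>UNIV. LINT \<omega>:state_action_event t s a|M. G \<omega>)"
    using assms by (intro set_integral_finite_Union set_integrable_of_integrable)
      (auto simp: disjoint_family_on_def)
  finally show ?thesis .
qed

lemma integral_sum_states:
  fixes G :: "'w \<Rightarrow> 'b::{banach, second_countable_topology}"
  assumes "integrable M G"
  shows "(\<integral>\<omega>. G \<omega> \<partial>M) = (\<Sum>s\<in>UNIV. LINT \<omega>:state_event t s|M. G \<omega>)"
proof -
  have "space M \<inter> state_event t s = state_event t s" for s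
    by auto
  then show ?thesis
    using set_integral_sum_states[OF assms, of "space M" t] assms
    by (simp add: set_integral_space)
qed

section \<open>Importance sampling\<close>

lemma integrable_ratio_scaleR:
  fixes G :: "'w \<Rightarrow> 'b::{banach, second_countable_topology}" and g :: "'w \<Rightarrow> real"
  assumes G: "simple_function (past t) G" and g: "integrable M g"
  shows "integrable M (\<lambda>\<omega>. (is_ratio S A \<pi> \<mu> t \<omega> * g \<omega>) *\<^sub>R G \<omega>)"
proof -
  \<comment> \<open>Finitely many states and actions make the ratio finitely valued, so it can be
    absorbed into the simple factor, leaving \<open>g\<close> as the only general integrand.\<close>
  have "simple_function M (\<lambda>\<omega>. is_ratio S A \<pi> \<mu> t \<omega>)"
    unfolding is_ratio_def
    by (rule simple_function_compose2[OF simple_function_past[OF simple_function_state]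
        simple_function_past[OF simple_function_action]])
  then have "simple_function M (\<lambda>\<omega>. is_ratio S A \<pi> \<mu> t \<omega> *\<^sub>R G \<omega>)"
    by (rule simple_function_compose2[OF _ simple_function_past[OF G]])
  then have "integrable M (\<lambda>\<omega>. g \<omega> *\<^sub>R (is_ratio S A \<pi> \<mu> t \<omega> *\<^sub>R G \<omega>))"
    by (rule integrable_scaleR_simple_function[OF _ g])
  then show ?thesis
    by (simp add: mult.commute)
qed

text \<open>On each state-action event the ratio is constant, and its denominator cancels the factor
  \<open>pmf (\<mu> s) a\<close> coming from the action law, so that \<pi> takes the place of \<mu>.
  The choices 1, a successor indicator and the reward for \<open>h\<close> serve the means, the
  transitions and the vector \<open>b\<close>.\<close>

lemma set_integral_importance_sampling:
  fixes G :: "'w \<Rightarrow> 'b::{banach, second_countable_topology}" and h :: "real \<times> 's \<Rightarrow> real"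
  assumes coverage: "\<And>s a. pmf (\<pi> s) a > 0 \<Longrightarrow> pmf (\<mu> s) a > 0"
    and G: "simple_function (past t) G"
    and h: "h \<in> borel_measurable (borel \<Otimes>\<^sub>M count_space UNIV)"
    and int: "integrable M (\<lambda>\<omega>. h (R (Suc t) \<omega>, S (Suc t) \<omega>))"
  shows "(LINT \<omega>:state_event t s|M.
      (is_ratio S A \<pi> \<mu> t \<omega> * h (R (Suc t) \<omega>, S (Suc t) \<omega>)) *\<^sub>R G \<omega>)
    = (\<Sum>a\<in>UNIV. pmf (\<pi> s) a * (\<integral>x. h x \<partial>q s a)) *\<^sub>R (LINT \<omega>:state_event t s|M. G \<omega>)"
proof -
  let ?X = "\<lambda>\<omega>. (R (Suc t) \<omega>, S (Suc t) \<omega>)"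
  \<comment> \<open>If the target probability is 0, both sides vanish even for a zero denominator;
    otherwise coverage makes the denominator positive.\<close>
  have ratio: "pmf (\<pi> s) a / pmf (\<mu> s) a * pmf (\<mu> s) a = pmf (\<pi> s) a" for a
  proof (cases "pmf (\<pi> s) a = 0")
    case False
    then have "pmf (\<mu> s) a > 0"
      by (intro coverage) (simp add: pmf_positive_iff set_pmf_iff)
    then show ?thesis
      by simp
  qed simp
  have "(LINT \<omega>:state_event t s|M. (is_ratio S A \<pi> \<mu> t \<omega> * h (?X \<omega>)) *\<^sub>R G \<omega>) =
      (\<Sum>a\<in>UNIV. LINT \<omega>:state_action_event t s a|M. (is_ratio S A \<pi> \<mu> t \<omega> * h (?X \<omega>)) *\<^sub>R G \<omega>)"
    by (intro set_integral_sum_actions integrable_ratio_scaleR G int)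
  also have "\<dots> = (\<Sum>a\<in>UNIV. LINT \<omega>:state_action_event t s a|M.
      (pmf (\<pi> s) a / pmf (\<mu> s) a) *\<^sub>R (h (?X \<omega>) *\<^sub>R G \<omega>))"
    by (intro sum.cong refl set_lebesgue_integral_cong) (auto simp: is_ratio_def)
  also have "\<dots> = (\<Sum>a\<in>UNIV. ((pmf (\<pi> s) a / pmf (\<mu> s) a * pmf (\<mu> s) a) * (\<integral>x. h x \<partial>q s a))
      *\<^sub>R (LINT \<omega>:state_event t s|M. G \<omega>))"
    unfolding set_integral_scaleR_right set_integral_transition[OF G h int] set_integral_action[OF G]
    by (intro sum.cong refl) (simp only: scaleR_scaleR mult_ac)
  finally show ?thesis
    by (simp only: ratio scaleR_sum_left)
qed

lemma set_integral_ratio: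
  fixes G :: "'w \<Rightarrow> 'b::{banach, second_countable_topology}"
  assumes coverage: "\<And>s a. pmf (\<pi> s) a > 0 \<Longrightarrow> pmf (\<mu> s) a > 0"
    and G: "simple_function (past t) G"
  shows "(LINT \<omega>:state_event t s|M. is_ratio S A \<pi> \<mu> t \<omega> *\<^sub>R G \<omega>) = (LINT \<omega>:state_event t s|M. G \<omega>)"
proof -
  have "(\<Sum>a\<in>UNIV. pmf (\<pi> s) a * (\<integral>x. 1 \<partial>q s a)) = 1"
    by (simp add: prob_space.prob_space[OF kernel_prob] sum_pmf_eq_1)
  moreover have "(LINT \<omega>:state_event t s|M. (is_ratio S A \<pi> \<mu> t \<omega> * 1) *\<^sub>R G \<omega>) =
      (\<Sum>a\<in>UNIV. pmf (\<pi> s) a * (\<integral>x. 1 \<partial>q s a)) *\<^sub>R (LINT \<omega>:state_event t s|M. G \<omega>)"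
    by (rule set_integral_importance_sampling[OF coverage G]) simp_all
  ultimately show ?thesis
    by simp
qed

text \<open>The indicator of the successor state is taken for \<open>h\<close>; its integral under
  the kernel is the state marginal, and averaging over \<pi> yields the entry of the transition
  matrix.\<close>

lemma set_integral_ratio_successor:
  fixes G :: "'w \<Rightarrow> 'b::{banach, second_countable_topology}"
  assumes coverage: "\<And>s a. pmf (\<pi> s) a > 0 \<Longrightarrow> pmf (\<mu> s) a > 0"
    and G: "simple_function (past t) G"
  shows "(LINT \<omega>:state_event t s \<inter> state_event (Suc t) s'|M. is_ratio S A \<pi> \<mu> t \<omega> *\<^sub>R G \<omega>)
    = transition_matrix p \<pi> $ s $ s' *\<^sub>R (LINT \<omega>:state_event t s|M. G \<omega>)"
proof -
  let ?X = "\<lambda>\<omega>. (R (Suc t) \<omega>, S (Suc t) \<omega>)"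
  let ?h = "indicat_real (UNIV \<times> {s'}) :: real \<times> 's \<Rightarrow> real"
  have h: "?h \<in> borel_measurable (borel \<Otimes>\<^sub>M count_space UNIV)"
    by (intro borel_measurable_indicator pair_measureI) auto
  have int_h: "(\<integral>x. ?h x \<partial>q s a) = pmf (p s a) s'" for a
    using kernel_sets[of s a] by (simp add: kernel_marginal sets_eq_imp_space_eq[OF kernel_sets] space_pair_measure)
  have "integrable M (indicat_real (state_event (Suc t) s'))"
    by (simp add: less_top[symmetric])
  then have int: "integrable M (\<lambda>\<omega>. ?h (?X \<omega>))"
    by (rule Bochner_Integration.integrable_cong[THEN iffD1, rotated 2]) (auto simp: indicator_def)
  have "(LINT \<omega>:state_event t s \<inter> state_event (Suc t) s'|M. is_ratio S A \<pi> \<mu> t \<omega> *\<^sub>R G \<omega>) =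
      (LINT \<omega>:state_event t s|M. (is_ratio S A \<pi> \<mu> t \<omega> * ?h (?X \<omega>)) *\<^sub>R G \<omega>)"
    unfolding set_lebesgue_integral_def
    by (intro Bochner_Integration.integral_cong) (auto simp: indicator_def)
  then show ?thesis
    by (simp only: set_integral_importance_sampling[OF coverage G h int] int_h)
       (simp add: transition_matrix_def)
qed

lemma set_integral_successor:
  fixes G :: "'w \<Rightarrow> 'b::{banach, second_countable_topology}"
  assumes coverage: "\<And>s a. pmf (\<pi> s) a > 0 \<Longrightarrow> pmf (\<mu> s) a > 0"
    and G: "simple_function (past t) G"
  shows "(LINT \<omega>:state_event (Suc t) s'|M. is_ratio S A \<pi> \<mu> t \<omega> *\<^sub>R G \<omega>)
    = (\<Sum>s\<in>UNIV. transition_matrix p \<pi> $ s $ s' *\<^sub>R (LINT \<omega>:state_event t s|M. G \<omega>))"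
proof -
  have "integrable M (\<lambda>\<omega>. is_ratio S A \<pi> \<mu> t \<omega> *\<^sub>R G \<omega>)"
    using integrable_ratio_scaleR[OF G, of "\<lambda>_. 1" \<pi>] by simp
  from set_integral_sum_states[OF this state_event_sets, of "Suc t" s' t] show ?thesis
    by (simp add: Int_commute[of "state_event (Suc t) s'"]
        set_integral_ratio_successor[OF coverage G])
qed

end

section \<open>Emphatic TD\<close>

lemma bounded_linear_outer: "bounded_linear (\<lambda>u. outer u v)"
  by (rule linear_conv_bounded_linear[THEN iffD1])
     (simp add: linear_iff vec_eq_iff outer_def algebra_simps)

locale emphatic_td = behavior_trajectory M S A R p q \<mu>
  for M :: "'w measure"
    and S :: "nat \<Rightarrow> 'w \<Rightarrow> 's::finite"
    and A :: "nat \<Rightarrow> 'w \<Rightarrow> 'a::finite"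
    and R :: "nat \<Rightarrow> 'w \<Rightarrow> real"
    and p :: "'s \<Rightarrow> 'a \<Rightarrow> 's pmf"
    and q :: "'s \<Rightarrow> 'a \<Rightarrow> (real \<times> 's) measure"
    and \<mu> :: "'s \<Rightarrow> 'a pmf" +
  fixes \<pi> :: "'s \<Rightarrow> 'a pmf"
    and d \<gamma> lam i :: "'s \<Rightarrow> real"
    and \<phi> :: "'s \<Rightarrow> real^'n"
  assumes stationary: "\<And>s. (\<lambda>t. measure M {\<omega> \<in> space M. S t \<omega> = s}) \<longlonglongrightarrow> d s"
    and stationary_pos: "\<And>s. d s > 0"
    and coverage: "\<And>s a. pmf (\<pi> s) a > 0 \<Longrightarrow> pmf (\<mu> s) a > 0"
    and discount: "\<And>s. 0 \<le> \<gamma> s \<and> \<gamma> s \<le> 1"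
    and bootstrapping: "\<And>s. 0 \<le> lam s \<and> lam s \<le> 1"
    and interest: "\<And>s. i s > 0"
    and followon_convergent:
      "\<And>s. convergent (\<lambda>t. expectation_given M (followon S A \<pi> \<mu> \<gamma> i t) {\<omega> \<in> space M. S t \<omega> = s})"
    and eligibility_convergent:
      "\<And>s. convergent (\<lambda>t. expectation_given M (eligibility S A \<pi> \<mu> \<gamma> lam i \<phi> t) {\<omega> \<in> space M. S t \<omega> = s})"
begin

abbreviation "ratio t \<equiv> is_ratio S A \<pi> \<mu> t"
abbreviation "F t \<equiv> followon S A \<pi> \<mu> \<gamma> i t"
abbreviation "emph t \<equiv> emphasis S A \<pi> \<mu> \<gamma> lam i t"
abbreviation "elig t \<equiv> eligibility S A \<pi> \<mu> \<gamma> lam i \<phi> t"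
abbreviation "P \<equiv> transition_matrix p \<pi>"

text \<open>The trace before multiplication by \<open>\<rho>\<^sub>t\<close>; unlike the trace itself it does not depend on the
  action at time \<open>t\<close>.\<close>

definition pretrace :: "nat \<Rightarrow> 'w \<Rightarrow> real^'n" where
  "pretrace t \<omega> =
    (case t of 0 \<Rightarrow> 0 | Suc k \<Rightarrow> (\<gamma> (S t \<omega>) * lam (S t \<omega>)) *\<^sub>R elig k \<omega>) + emph t \<omega> *\<^sub>R \<phi> (S t \<omega>)"

lemma trace_eq: "elig t \<omega> = ratio t \<omega> *\<^sub>R pretrace t \<omega>"
  by (cases t) (simp_all add: pretrace_def)

section \<open>Dependence of the algorithm's variables on the past\<close>

lemma simple_function_ratio: "simple_function (past (Suc t)) (ratio t)"
  unfolding is_ratio_def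
  by (rule simple_function_compose2[OF simple_function_past_mono[OF simple_function_state]
      simple_function_action]) simp

lemma simple_function_followon: "simple_function (past t) (F t)"
proof (induction t)
  case 0
  then show ?case
    using simple_function_compose1[OF simple_function_state] by simp
next
  case (Suc t)
  have "simple_function (past (Suc t)) (\<lambda>\<omega>. (S (Suc t) \<omega>, ratio t \<omega>, F t \<omega>))"
    by (intro simple_function_Pair simple_function_state simple_function_ratio
        simple_function_past_mono[OF Suc.IH]) simp
  from simple_function_compose1[OF this, of "\<lambda>(s, r, f). r * \<gamma> s * f + i s"] show ?case
    by simp
qed

lemma simple_function_emphasis: "simple_function (past t) (emph t)"
  using simple_function_compose2[OF simple_function_state simple_function_followon,
      of t "\<lambda>s f. lam s * i s + (1 - lam s) * f"]
  by (simp add: emphasis_def[abs_def])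

lemma simple_function_emphasis_features: "simple_function (past t) (\<lambda>\<omega>. emph t \<omega> *\<^sub>R \<phi> (S t \<omega>))"
  using simple_function_compose2[OF simple_function_emphasis simple_function_state,
      of t "\<lambda>m s. m *\<^sub>R \<phi> s"] by simp

lemma simple_function_trace_of_pretrace:
  "simple_function (past t) (pretrace t) \<Longrightarrow> simple_function (past (Suc t)) (elig t)"
  unfolding trace_eq[abs_def]
  by (rule simple_function_compose2[OF simple_function_ratio simple_function_past_mono]) auto

text \<open>The induction alternates between pretrace and trace: multiplying by the ratio moves from
  \<open>past t\<close> to \<open>past (Suc t)\<close>, exactly where the next pretrace
  lives.\<close>

lemma simple_function_pretrace: "simple_function (past t) (pretrace t)"
proof (induction t)
  case 0
  then show ?case
    using simple_function_emphasis_features[of 0] by (simp add: pretrace_def[abs_def])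
next
  case (Suc t)
  have "simple_function (past (Suc t))
      (\<lambda>\<omega>. (\<lambda>s v. (\<gamma> s * lam s) *\<^sub>R v) (S (Suc t) \<omega>) (elig t \<omega>) + emph (Suc t) \<omega> *\<^sub>R \<phi> (S (Suc t) \<omega>))"
    by (rule simple_function_compose2[OF
        simple_function_compose2[OF simple_function_state simple_function_trace_of_pretrace[OF Suc.IH]]
        simple_function_emphasis_features])
  then show ?case
    by (simp add: pretrace_def[abs_def])
qed

lemma simple_function_trace: "simple_function (past (Suc t)) (elig t)"
  by (rule simple_function_trace_of_pretrace[OF simple_function_pretrace])

section \<open>Means on the state events, their recursions and limits\<close>

lemma followon_nonneg: "F t \<omega> \<ge> 0"
  by (induction t) (auto simp: is_ratio_def interest less_imp_le discount intro!: add_nonneg_nonneg mult_nonneg_nonneg)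

text \<open>The mean is left unnormalized: its recursion is linear and involves no division by state
  probabilities, which may be 0 at finite times.\<close>

definition followon_mean :: "nat \<Rightarrow> 's \<Rightarrow> real" where
  "followon_mean t s = (LINT \<omega>:state_event t s|M. F t \<omega>)"

definition trace_mean :: "nat \<Rightarrow> 's \<Rightarrow> real^'n" where
  "trace_mean t s = (LINT \<omega>:state_event t s|M. elig t \<omega>)"

text \<open>The vector \<open>f\<close> of the overview.\<close>

definition followon_limit :: "real^'s" where
  "followon_limit = (\<chi> s. d s * lim (\<lambda>t. expectation_given M (F t) (state_event t s)))"

text \<open>The matrix \<open>Z\<close> of the overview, with one row per state.\<close>

definition trace_limit :: "real^'n^'s" where
  "trace_limit = (\<chi> s. d s *\<^sub>R lim (\<lambda>t. expectation_given M (elig t) (state_event t s)))"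

text \<open>The diagonal \<open>m\<close> of the emphasis matrix, expressed through
  \<open>f\<close>; the agreement is \<open>emphasis_matrix_eq\<close>.\<close>

definition emphasis_limit :: "real^'s" where
  "emphasis_limit = (\<chi> s. lam s * i s * d s + (1 - lam s) * followon_limit $ s)"

lemma followon_mean_tendsto: "(\<lambda>t. followon_mean t s) \<longlonglongrightarrow> followon_limit $ s"
  using tendsto_scaleR[OF stationary followon_convergent[THEN convergent_LIMSEQ_iff[THEN iffD1]], of s s]
  by (simp add: followon_mean_def followon_limit_def set_integral_eq_expectation_given)

lemma trace_mean_tendsto: "(\<lambda>t. trace_mean t s) \<longlonglongrightarrow> trace_limit $ s"
  using tendsto_scaleR[OF stationary eligibility_convergent[THEN convergent_LIMSEQ_iff[THEN iffD1]], of s s]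
  by (simp add: trace_mean_def trace_limit_def set_integral_eq_expectation_given)

lemma followon_mean_Suc:
  "followon_mean (Suc t) s' =
    \<gamma> s' * (\<Sum>s\<in>UNIV. P $ s $ s' * followon_mean t s) + i s' * prob (state_event (Suc t) s')"
proof -
  have int: "integrable M (\<lambda>\<omega>. ratio t \<omega> *\<^sub>R F t \<omega>)"
    using integrable_ratio_scaleR[OF simple_function_followon, of "\<lambda>_. 1"] by simp
  have "followon_mean (Suc t) s' =
      (LINT \<omega>:state_event (Suc t) s'|M. \<gamma> s' *\<^sub>R (ratio t \<omega> *\<^sub>R F t \<omega>) + i s')"
    unfolding followon_mean_def by (rule set_lebesgue_integral_cong) auto
  also have "\<dots> = \<gamma> s' *\<^sub>R (LINT \<omega>:state_event (Suc t) s'|M. ratio t \<omega> *\<^sub>R F t \<omega>)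
      + (LINT \<omega>:state_event (Suc t) s'|M. i s')"
    unfolding set_integral_scaleR_right[symmetric]
    by (intro set_integral_add(2) set_integrable_of_integrable integrable_scaleR_right int
        integrable_const state_event_sets)
  also have "(LINT \<omega>:state_event (Suc t) s'|M. i s') = i s' * prob (state_event (Suc t) s')"
    by (simp add: set_integral_const)
  finally show ?thesis
    by (simp add: set_integral_successor[OF coverage simple_function_followon, simplified] followon_mean_def)
qed

text \<open>Both sides of the recursion \<open>followon_mean_Suc\<close> converge, so the assumed
  limits satisfy its fixed-point equation.\<close>

lemma followon_limit_eq:
  "followon_limit $ s' = \<gamma> s' * (\<Sum>s\<in>UNIV. P $ s $ s' * followon_limit $ s) + i s' * d s'"
proof (rule LIMSEQ_unique)
  show "(\<lambda>t. followon_mean (Suc t) s') \<longlonglongrightarrow> followon_limit $ s'"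
    by (rule LIMSEQ_Suc[OF followon_mean_tendsto])
  show "(\<lambda>t. followon_mean (Suc t) s') \<longlonglongrightarrow>
      \<gamma> s' * (\<Sum>s\<in>UNIV. P $ s $ s' * followon_limit $ s) + i s' * d s'"
    unfolding followon_mean_Suc
    by (intro tendsto_intros followon_mean_tendsto LIMSEQ_Suc[OF stationary])
qed

lemma transition_nonneg: "P $ s $ s' \<ge> 0"
  by (simp add: transition_matrix_def sum_nonneg)

lemma transition_row_sum: "(\<Sum>s'\<in>UNIV. P $ s $ s') = 1"
proof -
  have "(\<Sum>s'\<in>UNIV. P $ s $ s') = (\<Sum>a\<in>UNIV. pmf (\<pi> s) a * (\<Sum>s'\<in>UNIV. pmf (p s a) s'))"
    unfolding transition_matrix_def by (simp add: sum_distrib_left) (rule sum.swap)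
  then show ?thesis
    by (simp add: sum_pmf_eq_1)
qed

text \<open>Limits of nonnegative means are nonnegative; the fixed-point equation then adds the
  strictly positive term \<open>i s * d s\<close>.\<close>

lemma followon_limit_pos: "followon_limit $ s > 0"
proof -
  have nonneg: "followon_limit $ s \<ge> 0" for s
  proof (rule LIMSEQ_le_const[OF followon_mean_tendsto], intro exI allI impI)
    show "0 \<le> followon_mean t s" for t
      unfolding followon_mean_def set_lebesgue_integral_def
      by (intro Bochner_Integration.integral_nonneg) (simp add: followon_nonneg)
  qed
  then have "0 \<le> \<gamma> s * (\<Sum>s'\<in>UNIV. P $ s' $ s * followon_limit $ s')"
    by (intro mult_nonneg_nonneg sum_nonneg transition_nonneg) (simp_all add: discount)
  with followon_limit_eq[of s] show ?thesis
    using mult_pos_pos[OF interest[of s] stationary_pos[of s]] by linarith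
qed

lemma set_integral_emphasis:
  "(LINT \<omega>:state_event t s|M. emph t \<omega>) = lam s * i s * prob (state_event t s) + (1 - lam s) * followon_mean t s"
proof -
  have "(LINT \<omega>:state_event t s|M. emph t \<omega>) =
      (LINT \<omega>:state_event t s|M. lam s * i s + (1 - lam s) * F t \<omega>)"
    by (rule set_lebesgue_integral_cong) (auto simp: emphasis_def)
  also have "\<dots> = (LINT \<omega>:state_event t s|M. lam s * i s) + (LINT \<omega>:state_event t s|M. (1 - lam s) * F t \<omega>)"
    by (intro set_integral_add(2))
       (auto intro!: set_integrable_of_integrable integrable_past[OF simple_function_followon])
  finally show ?thesis
    by (simp add: set_integral_const followon_mean_def)
qed

lemma set_integral_emphasis_tendsto:
  "(\<lambda>t. LINT \<omega>:state_event t s|M. emph t \<omega>) \<longlonglongrightarrow> emphasis_limit $ s"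
  unfolding set_integral_emphasis emphasis_limit_def vec_lambda_beta
  by (intro tendsto_intros stationary followon_mean_tendsto)

lemma expectation_given_emphasis_tendsto:
  "(\<lambda>t. expectation_given M (emph t) (state_event t s)) \<longlonglongrightarrow> emphasis_limit $ s / d s"
  using tendsto_divide[OF set_integral_emphasis_tendsto stationary, of s s] stationary_pos[of s]
  by (simp add: expectation_given_def divide_inverse mult.commute)

lemma emphasis_matrix_eq:
  "emphasis_matrix M S A \<pi> \<mu> \<gamma> lam i d = diag_matrix (\<lambda>s. emphasis_limit $ s)"
  using stationary_pos
  by (simp add: emphasis_matrix_def limI[OF expectation_given_emphasis_tendsto] less_imp_neq[symmetric])

text \<open>Given the state, the ratio has conditional mean 1 and the pretrace is already determined
  before the action.\<close>

lemma trace_mean_eq_pretrace: "trace_mean t s = (LINT \<omega>:state_event t s|M. pretrace t \<omega>)"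
  unfolding trace_mean_def trace_eq
  by (rule set_integral_ratio[OF coverage simple_function_pretrace])

lemma trace_mean_Suc:
  "trace_mean (Suc t) s' = (\<gamma> s' * lam s') *\<^sub>R (\<Sum>s\<in>UNIV. P $ s $ s' *\<^sub>R trace_mean t s)
    + (LINT \<omega>:state_event (Suc t) s'|M. emph (Suc t) \<omega>) *\<^sub>R \<phi> s'"
proof -
  let ?E = "state_event (Suc t) s'"
  have "trace_mean (Suc t) s' =
      (LINT \<omega>:?E|M. (\<gamma> s' * lam s') *\<^sub>R elig t \<omega> + emph (Suc t) \<omega> *\<^sub>R \<phi> s')"
    unfolding trace_mean_eq_pretrace
    by (rule set_lebesgue_integral_cong) (auto simp: pretrace_def)
  also have "\<dots> = (LINT \<omega>:?E|M. (\<gamma> s' * lam s') *\<^sub>R elig t \<omega>) + (LINT \<omega>:?E|M. emph (Suc t) \<omega> *\<^sub>R \<phi> s')"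
    by (intro set_integral_add(2) set_integrable_of_integrable integrable_scaleR_right
        integrable_scaleR_left integrable_past[OF simple_function_trace]
        integrable_past[OF simple_function_emphasis] state_event_sets)
  also have "(LINT \<omega>:?E|M. emph (Suc t) \<omega> *\<^sub>R \<phi> s') = (LINT \<omega>:?E|M. emph (Suc t) \<omega>) *\<^sub>R \<phi> s'"
    by (intro set_integral_scaleR_left state_event_sets integrable_past[OF simple_function_emphasis])
  \<comment> \<open>The old trace carries the ratio at time \<open>t\<close>, which turns the
    behavior transition into the target transition; what remains are pretrace means, equal to the
    trace means.\<close>
  also have "(LINT \<omega>:?E|M. (\<gamma> s' * lam s') *\<^sub>R elig t \<omega>) =
      (\<gamma> s' * lam s') *\<^sub>R (\<Sum>s\<in>UNIV. P $ s $ s' *\<^sub>R trace_mean t s)"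
    unfolding set_integral_scaleR_right trace_eq trace_mean_eq_pretrace
    by (simp only: set_integral_successor[OF coverage simple_function_pretrace])
  finally show ?thesis .
qed

lemma trace_limit_eq:
  "trace_limit $ s' = (\<gamma> s' * lam s') *\<^sub>R (\<Sum>s\<in>UNIV. P $ s $ s' *\<^sub>R trace_limit $ s)
    + emphasis_limit $ s' *\<^sub>R \<phi> s'"
proof (rule LIMSEQ_unique)
  show "(\<lambda>t. trace_mean (Suc t) s') \<longlonglongrightarrow> trace_limit $ s'"
    by (rule LIMSEQ_Suc[OF trace_mean_tendsto])
  show "(\<lambda>t. trace_mean (Suc t) s') \<longlonglongrightarrow>
      (\<gamma> s' * lam s') *\<^sub>R (\<Sum>s\<in>UNIV. P $ s $ s' *\<^sub>R trace_limit $ s) + emphasis_limit $ s' *\<^sub>R \<phi> s'"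
    unfolding trace_mean_Suc
    by (intro tendsto_intros trace_mean_tendsto LIMSEQ_Suc[OF set_integral_emphasis_tendsto])
qed

text \<open>Once the current and the next state are both fixed, the right factor of the outer
  product is constant, and the ratio inside the trace supplies the transition probability under
  \<pi>.\<close>

lemma integral_etd_matrix:
  "(\<integral>\<omega>. etd_matrix S A \<pi> \<mu> \<gamma> lam i \<phi> t \<omega> \<partial>M) =
    (\<Sum>s\<in>UNIV. \<Sum>s'\<in>UNIV. outer (P $ s $ s' *\<^sub>R trace_mean t s) (\<phi> s - \<gamma> s' *\<^sub>R \<phi> s'))"
proof -
  let ?X = "etd_matrix S A \<pi> \<mu> \<gamma> lam i \<phi> t"
  have "simple_function (past (Suc t)) (\<lambda>\<omega>. (elig t \<omega>, S t \<omega>, S (Suc t) \<omega>))"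
    by (intro simple_function_Pair simple_function_trace simple_function_state
        simple_function_past_mono[OF simple_function_state]) simp
  from simple_function_compose1[OF this, of "\<lambda>(e, s, s'). outer e (\<phi> s - \<gamma> s' *\<^sub>R \<phi> s')"]
  have "simple_function (past (Suc t)) ?X"
    by (simp add: etd_matrix_def[abs_def])
  then have int: "integrable M ?X"
    by (rule integrable_past)
  have "(LINT \<omega>:state_event t s \<inter> state_event (Suc t) s'|M. ?X \<omega>) =
      outer (P $ s $ s' *\<^sub>R trace_mean t s) (\<phi> s - \<gamma> s' *\<^sub>R \<phi> s')" for s s'
  proof -
    let ?E = "state_event t s \<inter> state_event (Suc t) s'" and ?v = "\<phi> s - \<gamma> s' *\<^sub>R \<phi> s'"
    have "(LINT \<omega>:?E|M. ?X \<omega>) = (LINT \<omega>:?E|M. outer (elig t \<omega>) ?v)"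
      by (rule set_lebesgue_integral_cong) (auto simp: etd_matrix_def)
    also have "\<dots> = (\<integral>\<omega>. outer (indicator ?E \<omega> *\<^sub>R elig t \<omega>) ?v \<partial>M)"
      by (simp only: set_lebesgue_integral_def linear_simps(5)[OF bounded_linear_outer])
    also have "\<dots> = outer (LINT \<omega>:?E|M. elig t \<omega>) ?v"
      unfolding set_lebesgue_integral_def
      by (intro integral_bounded_linear[OF bounded_linear_outer] integrable_mult_indicator
          integrable_past[OF simple_function_trace] sets.Int state_event_sets)
    finally show ?thesis
      by (simp only: trace_eq trace_mean_eq_pretrace
          set_integral_ratio_successor[OF coverage simple_function_pretrace])
  qed
  then show ?thesis
    by (simp add: integral_sum_states[OF int, of t]
        set_integral_sum_states[OF int state_event_sets, of _ _ "Suc t"])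
qed

text \<open>The reward plays the part of \<open>h\<close> in importance sampling, producing the
  expected reward under \<pi>; stability also asks for the limit of these vectors.\<close>

lemma integral_etd_vector:
  "(\<integral>\<omega>. etd_vector S A R \<pi> \<mu> \<gamma> lam i \<phi> t \<omega> \<partial>M) =
    (\<Sum>s\<in>UNIV. (\<Sum>a\<in>UNIV. pmf (\<pi> s) a * (\<integral>x. fst x \<partial>q s a)) *\<^sub>R trace_mean t s)"
proof -
  have R: "integrable M (\<lambda>\<omega>. fst (R (Suc t) \<omega>, S (Suc t) \<omega>))"
    by (simp add: reward_integrable)
  have eq: "etd_vector S A R \<pi> \<mu> \<gamma> lam i \<phi> t =
      (\<lambda>\<omega>. (ratio t \<omega> * fst (R (Suc t) \<omega>, S (Suc t) \<omega>)) *\<^sub>R pretrace t \<omega>)"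
    by (simp add: fun_eq_iff etd_vector_def trace_eq)
  have "(LINT \<omega>:state_event t s|M. (ratio t \<omega> * fst (R (Suc t) \<omega>, S (Suc t) \<omega>)) *\<^sub>R pretrace t \<omega>) =
      (\<Sum>a\<in>UNIV. pmf (\<pi> s) a * (\<integral>x. fst x \<partial>q s a)) *\<^sub>R trace_mean t s" for s
    unfolding trace_mean_eq_pretrace
    by (rule set_integral_importance_sampling[OF coverage simple_function_pretrace measurable_fst R])
  then show ?thesis
    unfolding eq
    by (simp only: integral_sum_states[OF integrable_ratio_scaleR[OF simple_function_pretrace R], where t = t])
qed

lemma integral_etd_matrix_tendsto:
  "(\<lambda>t. \<integral>\<omega>. etd_matrix S A \<pi> \<mu> \<gamma> lam i \<phi> t \<omega> \<partial>M) \<longlonglongrightarrow>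
    (\<Sum>s\<in>UNIV. \<Sum>s'\<in>UNIV. outer (P $ s $ s' *\<^sub>R trace_limit $ s) (\<phi> s - \<gamma> s' *\<^sub>R \<phi> s'))"
  unfolding integral_etd_matrix
  by (intro tendsto_sum bounded_linear.tendsto[OF bounded_linear_outer] tendsto_scaleR tendsto_const
      trace_mean_tendsto)

lemma integral_etd_vector_tendsto:
  "(\<lambda>t. \<integral>\<omega>. etd_vector S A R \<pi> \<mu> \<gamma> lam i \<phi> t \<omega> \<partial>M) \<longlonglongrightarrow>
    (\<Sum>s\<in>UNIV. (\<Sum>a\<in>UNIV. pmf (\<pi> s) a * (\<integral>x. fst x \<partial>q s a)) *\<^sub>R trace_limit $ s)"
  unfolding integral_etd_vector
  by (intro tendsto_sum tendsto_scaleR tendsto_const trace_mean_tendsto)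

end

section \<open>Matrix form of the limits and positive definiteness\<close>

context emphatic_td
begin

abbreviation "Q \<equiv> P ** diag_matrix \<gamma>"
abbreviation "K \<equiv> Q ** diag_matrix lam"

lemma followon_limit_mult_Q: "(followon_limit v* Q) $ s = followon_limit $ s - i s * d s"
  using followon_limit_eq[of s] by (simp add: vector_matrix_mult_def sum_distrib_left mult_ac)

lemma followon_limit_mult_K:
  "(followon_limit v* K) $ s = lam s * (followon_limit $ s - i s * d s)"
  unfolding followon_limit_mult_Q[symmetric]
  by (simp add: vector_matrix_mult_def sum_distrib_left mult_ac)

lemma emphasis_limit_nonneg: "emphasis_limit $ s \<ge> 0"
  using bootstrapping[of s] interest[of s] stationary_pos[of s] followon_limit_pos[of s]
  by (simp add: emphasis_limit_def)

text \<open>The vector \<open>f\<close> strictly dominates \<open>f v* K\<close>, which is the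
  hypothesis of \<open>neumann_series\<close>. The inverse \<open>N\<close> then sums the bootstrap
  series in closed form.\<close>

lemma bootstrap_neumann:
  obtains N where "bootstrap_term p \<pi> \<gamma> lam sums (mat 1 - N ** (mat 1 - Q))"
    "\<And>s s'. N $ s $ s' \<ge> 0" "\<And>s s'. s \<noteq> s' \<Longrightarrow> (N ** (mat 1 - Q)) $ s $ s' \<le> 0"
    "N ** (mat 1 - K) = mat 1" "(mat 1 - K) ** N = mat 1"
proof -
  have Q: "Q $ s $ s' \<ge> 0" for s s'
    by (simp add: transition_nonneg discount)
  have "K $ s $ s' \<ge> 0" for s s'
    using Q[of s s'] bootstrapping[of s'] by simp
  moreover have "(followon_limit v* K) $ s < followon_limit $ s" for s
  proof -
    \<comment> \<open>This says that \<open>f - i d\<close> is nonnegative, so replacing the factor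
      \<open>lam s\<close> by 1 can only enlarge the product.\<close>
    have "0 \<le> (followon_limit v* Q) $ s"
      by (auto simp: vector_matrix_mult_def transition_nonneg discount less_imp_le[OF followon_limit_pos]
          intro!: sum_nonneg mult_nonneg_nonneg)
    then have "(followon_limit v* K) $ s \<le> 1 * (followon_limit $ s - i s * d s)"
      unfolding followon_limit_mult_K using bootstrapping[of s]
      by (intro mult_right_mono) (auto simp: followon_limit_mult_Q)
    also have "\<dots> < followon_limit $ s"
      using interest[of s] stationary_pos[of s] by simp
    finally show ?thesis .
  qed
  ultimately obtain N where N: "matrix_power K sums N" and N_nonneg: "\<And>s s'. N $ s $ s' \<ge> 0"
    and inverse: "N ** (mat 1 - K) = mat 1" "(mat 1 - K) ** N = mat 1"
    using neumann_series[of K followon_limit] followon_limit_pos by blast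
  let ?C = "Q ** (mat 1 - diag_matrix lam)"
  have eq: "N ** ?C = mat 1 - N ** (mat 1 - Q)"
  proof -
    \<comment> \<open>Written as a difference so that multiplication by \<open>N\<close> turns the
      first part into the identity.\<close>
    have "?C = (mat 1 - K) - (mat 1 - Q)"
      by (simp add: matrix_diff_ldistrib)
    then show ?thesis
      by (simp only: matrix_diff_ldistrib[of N "mat 1 - K"] inverse)
  qed
  have "bootstrap_term p \<pi> \<gamma> lam = (\<lambda>k. matrix_power K k ** ?C)"
    by (simp add: fun_eq_iff bootstrap_term_def matrix_mul_assoc)
  then have "bootstrap_term p \<pi> \<gamma> lam sums (N ** ?C)"
    using bounded_linear.sums[OF bounded_linear_matrix_mult_right N] by simp
  \<comment> \<open>Off the diagonal the identity contributes nothing, and the entry is minus that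
    of the nonnegative product \<open>N ** ?C\<close>.\<close>
  moreover have "(N ** (mat 1 - Q)) $ s $ s' \<le> 0" if "s \<noteq> s'" for s s'
  proof -
    have "?C $ r $ r' \<ge> 0" for r r'
      using Q[of r r'] bootstrapping[of r'] by (simp add: matrix_diff_ldistrib mult_left_le)
    with N_nonneg have "0 \<le> (N ** ?C) $ s $ s'"
      by (rule matrix_mult_nonneg)
    then show ?thesis
      using that unfolding eq by (simp add: mat_def)
  qed
  ultimately show ?thesis
    using that N_nonneg inverse unfolding eq by blast
qed

text \<open>Since the rows of \<open>P\<close> sum to 1, the term \<phi> at the current state leaves
  the sum over successors and yields the identity in \<open>mat 1 - Q\<close>.\<close>

lemma etd_limit_eq:
  "(\<Sum>s\<in>UNIV. \<Sum>s'\<in>UNIV. outer (P $ s $ s' *\<^sub>R trace_limit $ s) (\<phi> s - \<gamma> s' *\<^sub>R \<phi> s')) =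
    transpose trace_limit ** ((mat 1 - Q) ** feature_matrix \<phi>)"
proof -
  have "((mat 1 - Q) ** feature_matrix \<phi>) $ s $ k =
      (\<Sum>s'\<in>UNIV. P $ s $ s' * (\<phi> s $ k - \<gamma> s' * \<phi> s' $ k))" for s k
  proof -
    have "(\<Sum>s'\<in>UNIV. P $ s $ s' * (\<phi> s $ k - \<gamma> s' * \<phi> s' $ k)) =
        (\<Sum>s'\<in>UNIV. P $ s $ s') * \<phi> s $ k - (\<Sum>s'\<in>UNIV. P $ s $ s' * \<gamma> s' * \<phi> s' $ k)"
      by (simp add: right_diff_distrib sum_subtractf sum_distrib_right mult.assoc)
    also have "\<dots> = \<phi> s $ k - (Q ** feature_matrix \<phi>) $ s $ k"
      unfolding transition_row_sum by (simp add: matrix_matrix_mult_def[of Q] feature_matrix_def)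
    finally show ?thesis
      by (simp add: matrix_diff_rdistrib feature_matrix_def)
  qed
  then show ?thesis
    by (simp add: vec_eq_iff outer_def transpose_matrix_mult_nth sum_distrib_left mult_ac)
qed

lemma trace_limit_mult:
  "transpose trace_limit ** (mat 1 - K) =
    transpose (feature_matrix \<phi>) ** diag_matrix (\<lambda>s. emphasis_limit $ s)"
proof -
  have "trace_limit $ s $ j - (transpose trace_limit ** K) $ j $ s = \<phi> s $ j * emphasis_limit $ s" for j s
    using arg_cong[OF trace_limit_eq[of s], of "\<lambda>v. v $ j"]
    by (simp add: transpose_matrix_mult_nth sum_distrib_left mult_ac)
  then show ?thesis
    by (simp add: vec_eq_iff matrix_diff_ldistrib transpose_def[of "_ :: real^'n^'s"] feature_matrix_def)
qed

lemma emphasis_limit_mult: "emphasis_limit = followon_limit v* (mat 1 - K)"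
  by (simp add: vec_eq_iff vector_matrix_mult_diff_rdistrib followon_limit_mult_K emphasis_limit_def
      algebra_simps)

text \<open>Here \<open>C\<close> stands for the identity minus the bootstrap matrix; inserting
  \<open>(mat 1 - K) ** N\<close> after the transposed trace limit brings out the emphasis.\<close>

lemma etd_limit_factorization:
  obtains C where "bootstrap_term p \<pi> \<gamma> lam sums (mat 1 - C)"
    "transpose trace_limit ** ((mat 1 - Q) ** feature_matrix \<phi>) =
      transpose (feature_matrix \<phi>) ** diag_matrix (\<lambda>s. emphasis_limit $ s) ** C ** feature_matrix \<phi>"
    "positive_definite (diag_matrix (\<lambda>s. emphasis_limit $ s) ** C)"
proof -
  obtain N where sums: "bootstrap_term p \<pi> \<gamma> lam sums (mat 1 - N ** (mat 1 - Q))"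
    and N_nonneg: "\<And>s s'. N $ s $ s' \<ge> 0"
    and off_diagonal: "\<And>s s'. s \<noteq> s' \<Longrightarrow> (N ** (mat 1 - Q)) $ s $ s' \<le> 0"
    and inverse: "N ** (mat 1 - K) = mat 1" "(mat 1 - K) ** N = mat 1"
    using bootstrap_neumann by blast
  let ?C = "N ** (mat 1 - Q)" and ?D = "diag_matrix (\<lambda>s. emphasis_limit $ s)"
  have "transpose trace_limit = transpose trace_limit ** ((mat 1 - K) ** N)"
    by (simp add: inverse)
  also have "\<dots> = transpose (feature_matrix \<phi>) ** ?D ** N"
    unfolding matrix_mul_assoc trace_limit_mult ..
  finally have "transpose trace_limit ** ((mat 1 - Q) ** feature_matrix \<phi>) =
      transpose (feature_matrix \<phi>) ** ?D ** ?C ** feature_matrix \<phi>"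
    by (simp add: matrix_mul_assoc)
  moreover have "positive_definite (?D ** ?C)"
  proof (rule positive_definite_diagonally_dominant)
    fix s s' :: 's assume "s \<noteq> s'"
    then show "(?D ** ?C) $ s $ s' \<le> 0"
      using off_diagonal[of s s'] emphasis_limit_nonneg[of s] by (simp add: mult_nonneg_nonpos)
  next
    fix s :: 's
    \<comment> \<open>Discounts of at most 1 keep the row sums of \<open>Q\<close> below those of
      \<open>P\<close>, so \<open>mat 1 - Q\<close> has nonnegative row sums; the nonnegative
      factors \<open>N\<close> and \<open>?D\<close> preserve this.\<close>
    have "(\<Sum>s'\<in>UNIV. Q $ r $ s') \<le> (\<Sum>s'\<in>UNIV. P $ r $ s')" for r
      by (intro sum_mono) (simp add: transition_nonneg discount mult_left_le)
    then have "0 \<le> (\<Sum>s'\<in>UNIV. (mat 1 - Q) $ r $ s')" for r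
      by (simp add: sum_subtractf transition_row_sum mat_def)
    then have "0 \<le> (\<Sum>s'\<in>UNIV. ?C $ s $ s')"
      unfolding row_sum_matrix_mult by (rule sum_nonneg[OF mult_nonneg_nonneg[OF N_nonneg]])
    then show "0 \<le> (\<Sum>s'\<in>UNIV. (?D ** ?C) $ s $ s')"
      using emphasis_limit_nonneg[of s] by (simp flip: sum_distrib_left)
  next
    fix s' :: 's
    \<comment> \<open>The column sums form the row vector \<open>m C\<close>. With
      \<open>m = f (I - K)\<close> the factor \<open>N\<close> cancels, leaving
      \<open>f (I - Q)\<close>, which is the positive vector \<open>i d\<close>.\<close>
    have "(\<Sum>s\<in>UNIV. (?D ** ?C) $ s $ s') = (emphasis_limit v* ?C) $ s'"
      by (simp add: vector_matrix_mult_def)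
    also have "\<dots> = (followon_limit v* ((mat 1 - K) ** N ** (mat 1 - Q))) $ s'"
      unfolding emphasis_limit_mult vector_matrix_mul_assoc matrix_mul_assoc ..
    also have "\<dots> = i s' * d s'"
      by (simp add: inverse vector_matrix_mult_diff_rdistrib followon_limit_mult_Q)
    finally show "0 < (\<Sum>s\<in>UNIV. (?D ** ?C) $ s $ s')"
      using interest[of s'] stationary_pos[of s'] by simp
  qed
  ultimately show ?thesis
    using that sums by blast
qed

end

section \<open>Limit matrix, positive definiteness and stability of emphatic TD\<close>

theorem theorem1:
  fixes M :: "'w measure"
    and S :: "nat \<Rightarrow> 'w \<Rightarrow> 's::finite"
    and Act :: "nat \<Rightarrow> 'w \<Rightarrow> 'a::finite"
    and R :: "nat \<Rightarrow> 'w \<Rightarrow> real"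
    and p :: "'s \<Rightarrow> 'a \<Rightarrow> 's pmf"
    and q :: "'s \<Rightarrow> 'a \<Rightarrow> (real \<times> 's) measure"
    and \<mu> \<pi> :: "'s \<Rightarrow> 'a pmf"
    and d\<^sub>\<mu> \<gamma> lam i :: "'s \<Rightarrow> real"
    and \<phi> :: "'s \<Rightarrow> real^'n"
  assumes trajectory: "behavior_trajectory M S Act R p q \<mu>"
    and stationary: "\<And>s. (\<lambda>t. measure M {\<omega> \<in> space M. S t \<omega> = s}) \<longlonglongrightarrow> d\<^sub>\<mu> s"
    and stationary_pos: "\<And>s. d\<^sub>\<mu> s > 0"
    and coverage: "\<And>s a. pmf (\<pi> s) a > 0 \<Longrightarrow> pmf (\<mu> s) a > 0"
    and discount: "\<And>s. 0 \<le> \<gamma> s \<and> \<gamma> s \<le> 1"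
    and discount_prod: "\<And>t. t > 0 \<Longrightarrow> AE \<omega> in M. (\<lambda>N. \<Prod>k=1..N. \<gamma> (S (t + k) \<omega>)) \<longlonglongrightarrow> 0"
    and bootstrapping: "\<And>s. 0 \<le> lam s \<and> lam s \<le> 1"
    and interest: "\<And>s. i s > 0"
    and features_distinct: "inj (\<lambda>j. column j (feature_matrix \<phi>))"
    and features_independent: "independent (columns (feature_matrix \<phi>))"
    and followon_limit:
      "\<And>s. convergent (\<lambda>t. expectation_given M (followon S Act \<pi> \<mu> \<gamma> i t) {\<omega> \<in> space M. S t \<omega> = s})"
    and eligibility_limit:
      "\<And>s. convergent (\<lambda>t. expectation_given M (eligibility S Act \<pi> \<mu> \<gamma> lam i \<phi> t) {\<omega> \<in> space M. S t \<omega> = s})"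
  shows "(\<forall>s. convergent (\<lambda>t. expectation_given M (emphasis S Act \<pi> \<mu> \<gamma> lam i t) {\<omega> \<in> space M. S t \<omega> = s})) \<and>
    summable (bootstrap_term p \<pi> \<gamma> lam) \<and>
    (\<exists>A. (\<lambda>t. \<integral>\<omega>. etd_matrix S Act \<pi> \<mu> \<gamma> lam i \<phi> t \<omega> \<partial>M) \<longlonglongrightarrow> A \<and>
      A = transpose (feature_matrix \<phi>) ** emphasis_matrix M S Act \<pi> \<mu> \<gamma> lam i d\<^sub>\<mu>
            ** (mat 1 - bootstrap_matrix p \<pi> \<gamma> lam) ** feature_matrix \<phi> \<and>
      positive_definite A) \<and>
    etd_stable M S Act R \<pi> \<mu> \<gamma> lam i \<phi>"
proof -
  interpret behavior_trajectory M S Act R p q \<mu>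
    by (rule trajectory)
  interpret emphatic_td M S Act R p q \<mu> \<pi> d\<^sub>\<mu> \<gamma> lam i \<phi>
    by unfold_locales
       (use stationary stationary_pos coverage discount bootstrapping interest followon_limit
          eligibility_limit in auto)
  let ?\<Phi> = "feature_matrix \<phi>"
  obtain C where sums: "bootstrap_term p \<pi> \<gamma> lam sums (mat 1 - C)"
    and eq: "transpose trace_limit ** ((mat 1 - Q) ** ?\<Phi>) =
      transpose ?\<Phi> ** diag_matrix (\<lambda>s. emphasis_limit $ s) ** C ** ?\<Phi>"
    and pos: "positive_definite (diag_matrix (\<lambda>s. emphasis_limit $ s) ** C)"
    using etd_limit_factorization by blast
  define X where "X = transpose ?\<Phi> ** diag_matrix (\<lambda>s. emphasis_limit $ s) ** C ** ?\<Phi>"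
  \<comment> \<open>\<open>bootstrap_matrix\<close> is a \<open>suminf\<close>; the convergence in
    \<open>sums\<close> identifies its value as \<open>mat 1 - C\<close>.\<close>
  have C: "mat 1 - bootstrap_matrix p \<pi> \<gamma> lam = C"
    unfolding bootstrap_matrix_def sums_unique[OF sums, symmetric] by simp
  have limit: "(\<lambda>t. \<integral>\<omega>. etd_matrix S Act \<pi> \<mu> \<gamma> lam i \<phi> t \<omega> \<partial>M) \<longlonglongrightarrow> X"
    using integral_etd_matrix_tendsto unfolding etd_limit_eq eq X_def .
  have "positive_definite X"
    using positive_definite_congruence[OF pos inj_matrix_independent_columns[OF features_distinct features_independent]]
    by (simp add: X_def matrix_mul_assoc)
  moreover have "etd_stable M S Act R \<pi> \<mu> \<gamma> lam i \<phi>"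
    unfolding etd_stable_def
    using limit integral_etd_vector_tendsto positive_definite_stable_iteration[OF \<open>positive_definite X\<close>]
    by blast
  moreover have "X = transpose ?\<Phi> ** emphasis_matrix M S Act \<pi> \<mu> \<gamma> lam i d\<^sub>\<mu>
      ** (mat 1 - bootstrap_matrix p \<pi> \<gamma> lam) ** ?\<Phi>"
    by (simp add: X_def C emphasis_matrix_eq)
  moreover have "convergent (\<lambda>t. expectation_given M (emphasis S Act \<pi> \<mu> \<gamma> lam i t) {\<omega> \<in> space M. S t \<omega> = s})" for s
    using expectation_given_emphasis_tendsto by (rule convergentI)
  ultimately show ?thesis
    using limit sums_summable[OF sums] by blast
qed

end
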